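(* Let $\mathbb{K}\in\{\mathbb{R},\mathbb{C}\}$, let $n\ge m$, let $\mathcal{G}$ be a DAG on the vertices $\{1,\dots,m\}$, let $f\in\mathbb{K}^{n\times m}$ be a sample and let $\widetilde f=f+f'$ be a stabilisation of $f$. Let $f_i$ and $v_i$ denote the columns of $f$ and $f'$ respectively. Then, in the DAG model on $\mathcal{G}$: (a) the MLE given $\widetilde f$ is unique; (b) the MLE given $\widetilde f$ is an MLE given $f$ if and only if for all child vertices $i$ in $\mathcal{G}$ we have $v_i\in\langle v_j: j\to i\rangle$ and $\overline{f_i}+v_i\in\langle f_j+v_j: j\to i\rangle$, where $\overline{f_i}$ is the orthogonal projection of $f_i$ onto $\langle f_j: j\to i\rangle$; (c) the MLE given $\widetilde f(\epsilon):=f+\epsilon f'$ is unique for all $\epsilon\neq0$, and has a well-defined limit as $\epsilon$ tends to zero, called the limit MLE given $\widetilde f$, which can be described explicitly: if there is at least one MLE given $f$, it is the unique MLE given $f$ whose edge-weight part is, at each child vertex $i$, the vector $(\lambda_{ij})_{j\in\mathrm{pa}(i)}=D_{i,l}/c_{i,l}$ defined in the context; (d) the limit MLE given $\widetilde f$ is an MLE given $f$, if one exists.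
   Context: $\mathbb{K}^n,\mathbb{K}^m$ carry the standard inner products $v\cdot w=\sum_k v_kw_k^*$ ($w_k^*$ the complex conjugate), $(\cdot)^{\mathsf T}$ is transpose (conjugate transpose if $\mathbb{K}=\mathbb{C}$), $\langle\cdot\rangle$ denotes linear span, and $\operatorname{adj}$ is the adjugate matrix. For a DAG $\mathcal{G}$ on $\{1,\dots,m\}$, $\mathrm{pa}(i)=\{j: j\to i\}$; a child vertex is a vertex $i$ with $\mathrm{pa}(i)\ne\emptyset$. DAG model on $\mathcal{G}$: parameters are pairs $(\Lambda,\omega)$ with $\Lambda=(\lambda_{ij})\in\mathbb{K}^{m\times m}$ (the edge weights), $\lambda_{ij}=0$ unless $j\to i$, and $\omega\in\mathbb{R}_{>0}^m$ (the variances); they give the mean-zero Gaussian with covariance $(I-\Lambda)^{-1}\mathrm{diag}(\omega)(I-\Lambda)^{-\mathsf T}$. A sample is a matrix $Y\in\mathbb{K}^{n\times m}$ (rows are observations) with columns $Y^{(1)},\dots,Y^{(m)}$, viewed as a linear map $\mathbb{K}^m\to\mathbb{K}^n$. An MLE given $Y$ is a parameter pair $(\Lambda,\omega)$ minimising the negative log-likelihood (up to constants) $$\sum_{i=1}^m\Big(\log\omega_i+\tfrac1{n\omega_i}\big\|Y^{(i)}-\sum_{j\in\mathrm{pa}(i)}\lambda_{ij}Y^{(j)}\big\|^2\Big).$$ "The MLE is unique" means that it exists and is unique. Given $f:\mathbb{K}^m\to\mathbb{K}^n$, an $f$-perturbation is a linear map $f':\mathbb{K}^m\to\mathbb{K}^n$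 with $\operatorname{im}f'\subseteq(\operatorname{im}f)^\perp$ and $(\ker f')^\perp=\ker f$. A stabilisation of $f$ is a sum $\widetilde f=f+f'$ with $f'$ an $f$-perturbation. For a child vertex $i$ suppose for simplicity of notation that $\mathrm{pa}(i)=\{1,\dots,p\}$. Let $A_i$ (resp. $E_i$) be the $n\times p$ matrix with columns $f_1,\dots,f_p$ (resp. $v_1,\dots,v_p$), let $\overline{v_i}$ be the orthogonal projection of $v_i$ onto $\langle v_j: j\to i\rangle$, and let $C_i'(\epsilon)=A_i^{\mathsf T}A_i+\epsilon E_i^{\mathsf T}E_i$. Put $$c_{i,l}=\operatorname{tr}\Big(\Big(\tfrac{d^{l-1}}{d\epsilon^{l-1}}\Big|_{\epsilon=0}\operatorname{adj}C_i'(\epsilon)\Big)E_i^{\mathsf T}E_i\Big),$$ $$D_{i,l}=\Big(\tfrac{d^{l}}{d\epsilon^{l}}\Big|_{\epsilon=0}\operatorname{adj}C_i'(\epsilon)\Big)\begin{pmatrix}f_1\cdot\overline{f_i}\\ \vdots\\ f_p\cdot\overline{f_i}\end{pmatrix}+\Big(\tfrac{d^{l-1}}{d\epsilon^{l-1}}\Big|_{\epsilon=0}\operatorname{adj}C_i'(\epsilon)\Big)\begin{pmatrix}v_1\cdot\overline{v_i}\\ \vdots\\ v_p\cdot\overline{v_i}\end{pmatrix},$$ where $l$ is the smallest integer in $\{1,\dots,p\}$ with $c_{i,l}\ne0$.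
   Formalization: In (b) the condition v_i=0 at all vertices without parents is added; in (c) l ranges over 0..p with c_{i,0}=det C_i'(0), the second term of D_{i,l} carries a factor l, and the products f_k·f̄_i, v_k·v̄_i are replaced by their complex conjugates. *)

theory Defs
  imports
    "HOL-Analysis.Derivative"
    "Jordan_Normal_Form.Schur_Decomposition"
    "Jordan_Normal_Form.Matrix_Kernel"
begin

unbundle no vec_syntax
unbundle no inner_syntax
hide_const (open) Finite_Cartesian_Product.vec Finite_Cartesian_Product.mat

section \<open>The fields of real and of complex numbers\<close>

text \<open>Up to isometric isomorphism the real numbers and the complex numbers are the only
  real normed fields (Gelfand--Mazur), and the class axiom makes \<^const>\<open>conjugate\<close> the
  complex conjugation. So this class stands for the phrase ``K is R or C''.\<close>

class real_or_complex = conjugatable_field + real_normed_field +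
  assumes mult_conjugate: "x * conjugate x = ((norm x)\<^sup>2) *\<^sub>R 1"

instance real :: real_or_complex
  by intro_classes (simp add: power2_eq_square)

instance complex :: real_or_complex
proof
  fix x :: complex
  show "x * conjugate x = ((norm x)\<^sup>2) *\<^sub>R 1"
    using complex_norm_square[of x] by (metis conjugate_complex_def of_real_def)
qed

section \<open>Linear algebra\<close>

text \<open>The standard inner product of the column vectors \<open>v\<close> and \<open>w\<close> is \<open>v \<bullet>c w\<close>;
  it is conjugate-linear in \<open>w\<close>.\<close>

abbreviation vspan :: "nat \<Rightarrow> 'a :: real_or_complex vec set \<Rightarrow> 'a vec set" where
  "vspan d S \<equiv> LinearCombinations.module.span class_ring (module_vec TYPE('a) d) S"

definition norm_sq :: "'a :: real_or_complex vec \<Rightarrow> real" where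
  "norm_sq v = (\<Sum>k<dim_vec v. (norm (v $ k))\<^sup>2)"

definition orth_compl :: "nat \<Rightarrow> 'a :: real_or_complex vec set \<Rightarrow> 'a vec set" where
  "orth_compl d W = {x \<in> carrier_vec d. \<forall>y\<in>W. x \<bullet>c y = 0}"

definition orth_proj :: "nat \<Rightarrow> 'a :: real_or_complex vec set \<Rightarrow> 'a vec \<Rightarrow> 'a vec" where
  "orth_proj d S w = (THE u. u \<in> vspan d S \<and> w - u \<in> orth_compl d (vspan d S))"

definition mat_image :: "'a :: real_or_complex mat \<Rightarrow> 'a vec set" where
  "mat_image f = (\<lambda>x. f *\<^sub>v x) ` carrier_vec (dim_col f)"

definition mat_trace :: "'a :: real_or_complex mat \<Rightarrow> 'a" where
  "mat_trace A = (\<Sum>k<dim_row A. A $$ (k, k))"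

text \<open>The entrywise \<open>l\<close>-th derivative at \<open>0\<close> of a curve of matrices of constant size.\<close>

definition mat_deriv0 :: "nat \<Rightarrow> ('a :: real_or_complex \<Rightarrow> 'a mat) \<Rightarrow> 'a mat" where
  "mat_deriv0 l M =
     mat (dim_row (M 0)) (dim_col (M 0)) (\<lambda>(r, s). (deriv ^^ l) (\<lambda>\<epsilon>. M \<epsilon> $$ (r, s)) 0)"

section \<open>Perturbations\<close>

text \<open>The stabilisations of \<open>f\<close> are the matrices \<open>f + f'\<close> with \<open>f'\<close> an \<open>f\<close>-perturbation.\<close>

definition perturbation ::
  "nat \<Rightarrow> nat \<Rightarrow> 'a :: real_or_complex mat \<Rightarrow> 'a mat \<Rightarrow> bool" where
  "perturbation n m f f' \<longleftrightarrow> f' \<in> carrier_mat n m \<and>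
     mat_image f' \<subseteq> orth_compl n (mat_image f) \<and>
     orth_compl m (mat_kernel f') = mat_kernel f"

section \<open>DAG models\<close>

text \<open>The vertices are \<open>0, \<dots>, m - 1\<close>, and \<open>(j, i) \<in> G\<close> is the edge from \<open>j\<close> to \<open>i\<close>.\<close>

definition dag :: "nat \<Rightarrow> (nat \<times> nat) set \<Rightarrow> bool" where
  "dag m G \<longleftrightarrow> G \<subseteq> {..<m} \<times> {..<m} \<and> acyclic G"

definition pa :: "(nat \<times> nat) set \<Rightarrow> nat \<Rightarrow> nat set" where
  "pa G i = {j. (j, i) \<in> G}"

type_synonym 'a param = "'a mat \<times> real vec"

definition dag_params :: "nat \<Rightarrow> (nat \<times> nat) set \<Rightarrow> 'a :: real_or_complex param set" where
  "dag_params m G = {(\<Lambda>, \<omega>). \<Lambda> \<in> carrier_mat m m \<and> \<omega> \<in> carrier_vec m \<and>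
     (\<forall>i<m. \<forall>j<m. (j, i) \<notin> G \<longrightarrow> \<Lambda> $$ (i, j) = 0) \<and> (\<forall>i<m. 0 < \<omega> $ i)}"

definition residual ::
  "nat \<Rightarrow> (nat \<times> nat) set \<Rightarrow> 'a :: real_or_complex mat \<Rightarrow> 'a mat \<Rightarrow> nat \<Rightarrow> 'a vec" where
  "residual n G Y \<Lambda> i =
     Matrix.vec n (\<lambda>k. Y $$ (k, i) - (\<Sum>j\<in>pa G i. \<Lambda> $$ (i, j) * Y $$ (k, j)))"

definition neg_log_lik ::
  "nat \<Rightarrow> nat \<Rightarrow> (nat \<times> nat) set \<Rightarrow> 'a :: real_or_complex mat \<Rightarrow> 'a param \<Rightarrow> real" where
  "neg_log_lik n m G Y = (\<lambda>(\<Lambda>, \<omega>).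
     \<Sum>i<m. ln (\<omega> $ i) + 1 / (real n * \<omega> $ i) * norm_sq (residual n G Y \<Lambda> i))"

definition is_mle ::
  "nat \<Rightarrow> nat \<Rightarrow> (nat \<times> nat) set \<Rightarrow> 'a :: real_or_complex mat \<Rightarrow> 'a param \<Rightarrow> bool" where
  "is_mle n m G Y p \<longleftrightarrow> is_arg_min (neg_log_lik n m G Y) (\<lambda>q. q \<in> dag_params m G) p"

definition mle ::
  "nat \<Rightarrow> nat \<Rightarrow> (nat \<times> nat) set \<Rightarrow> 'a :: real_or_complex mat \<Rightarrow> 'a param" where
  "mle n m G Y = (THE p. is_mle n m G Y p)"

text \<open>Limits are entrywise. The variances of a limit may vanish, hence a limit need not be a
  parameter of the model.\<close>

definition is_limit_mle ::
  "nat \<Rightarrow> nat \<Rightarrow> (nat \<times> nat) set \<Rightarrow> 'a :: real_or_complex mat \<Rightarrow> 'a mat \<Rightarrow> 'a param \<Rightarrow> bool"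
where
  "is_limit_mle n m G f f' = (\<lambda>(\<Lambda>, \<omega>). \<Lambda> \<in> carrier_mat m m \<and> \<omega> \<in> carrier_vec m \<and>
     (\<forall>i<m. \<forall>j<m. ((\<lambda>\<epsilon>. fst (mle n m G (f + \<epsilon> \<cdot>\<^sub>m f')) $$ (i, j)) \<longlongrightarrow> \<Lambda> $$ (i, j)) (at 0)) \<and>
     (\<forall>i<m. ((\<lambda>\<epsilon>. snd (mle n m G (f + \<epsilon> \<cdot>\<^sub>m f')) $ i) \<longlongrightarrow> \<omega> $ i) (at 0)))"

section \<open>The explicit formula for the limit\<close>

definition pa_list :: "(nat \<times> nat) set \<Rightarrow> nat \<Rightarrow> nat list" where
  "pa_list G i = sorted_list_of_set (pa G i)"

definition pa_cols ::
  "(nat \<times> nat) set \<Rightarrow> 'a :: real_or_complex mat \<Rightarrow> nat \<Rightarrow> 'a vec set" where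
  "pa_cols G Y i = col Y ` pa G i"

definition pa_mat ::
  "nat \<Rightarrow> (nat \<times> nat) set \<Rightarrow> 'a :: real_or_complex mat \<Rightarrow> nat \<Rightarrow> 'a mat" where
  "pa_mat n G Y i = mat_of_cols n (map (col Y) (pa_list G i))"

text \<open>The orthogonal projection of a column onto the span of its parent columns.\<close>

definition bar_col ::
  "nat \<Rightarrow> (nat \<times> nat) set \<Rightarrow> 'a :: real_or_complex mat \<Rightarrow> nat \<Rightarrow> 'a vec" where
  "bar_col n G Y i = orth_proj n (pa_cols G Y i) (col Y i)"

text \<open>The vector with entries \<open>bar_col n G Y i \<bullet>c col Y j\<close> for \<open>j\<close> in \<open>pa G i\<close>. Since the
  conjugate falls on the parent columns, this is the conjugate transpose of \<open>pa_mat n G Y i\<close>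
  applied to the projected column, as the normal equations require over the complex numbers.\<close>

definition pa_inner ::
  "nat \<Rightarrow> (nat \<times> nat) set \<Rightarrow> 'a :: real_or_complex mat \<Rightarrow> nat \<Rightarrow> 'a vec" where
  "pa_inner n G Y i = vec_of_list (map (\<lambda>j. bar_col n G Y i \<bullet>c col Y j) (pa_list G i))"

definition gram :: "'a :: real_or_complex mat \<Rightarrow> 'a mat" where
  "gram A = mat_adjoint A * A"

definition C_mat ::
  "nat \<Rightarrow> (nat \<times> nat) set \<Rightarrow> 'a :: real_or_complex mat \<Rightarrow> 'a mat \<Rightarrow> nat \<Rightarrow> 'a \<Rightarrow> 'a mat" where
  "C_mat n G f f' i \<epsilon> = gram (pa_mat n G f i) + \<epsilon> \<cdot>\<^sub>m gram (pa_mat n G f' i)"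

text \<open>By Jacobi's formula \<open>c_coeff n G f f' i l\<close> is the \<open>l\<close>-th derivative at \<open>0\<close> of
  the determinant of \<open>C_mat\<close>. The trace expression makes sense for positive \<open>l\<close> only, and
  the value of the determinant itself is needed when the parent columns of \<open>f\<close> are linearly
  independent.\<close>

fun c_coeff ::
  "nat \<Rightarrow> (nat \<times> nat) set \<Rightarrow> 'a :: real_or_complex mat \<Rightarrow> 'a mat \<Rightarrow> nat \<Rightarrow> nat \<Rightarrow> 'a" where
  "c_coeff n G f f' i 0 = det (C_mat n G f f' i 0)"
| "c_coeff n G f f' i (Suc k) =
     mat_trace (mat_deriv0 k (\<lambda>\<epsilon>. adj_mat (C_mat n G f f' i \<epsilon>)) * gram (pa_mat n G f' i))"

text \<open>The \<open>l\<close>-th derivative at \<open>0\<close> of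
  \<open>adj_mat (C_mat n G f f' i \<epsilon>) *\<^sub>v (pa_inner n G f i + \<epsilon> \<cdot>\<^sub>v pa_inner n G f' i)\<close>;
  the factor \<open>l\<close> of the second summand is the binomial coefficient of the Leibniz rule.\<close>

definition D_coeff ::
  "nat \<Rightarrow> (nat \<times> nat) set \<Rightarrow> 'a :: real_or_complex mat \<Rightarrow> 'a mat \<Rightarrow> nat \<Rightarrow> nat \<Rightarrow> 'a vec" where
  "D_coeff n G f f' i l =
     mat_deriv0 l (\<lambda>\<epsilon>. adj_mat (C_mat n G f f' i \<epsilon>)) *\<^sub>v pa_inner n G f i +
     of_nat l \<cdot>\<^sub>v
       (mat_deriv0 (l - 1) (\<lambda>\<epsilon>. adj_mat (C_mat n G f f' i \<epsilon>)) *\<^sub>v pa_inner n G f' i)"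

definition l_index ::
  "nat \<Rightarrow> (nat \<times> nat) set \<Rightarrow> 'a :: real_or_complex mat \<Rightarrow> 'a mat \<Rightarrow> nat \<Rightarrow> nat" where
  "l_index n G f f' i = (LEAST l. l \<le> card (pa G i) \<and> c_coeff n G f f' i l \<noteq> 0)"

definition explicit_weights ::
  "nat \<Rightarrow> nat \<Rightarrow> (nat \<times> nat) set \<Rightarrow> 'a :: real_or_complex mat \<Rightarrow> 'a mat \<Rightarrow> 'a mat \<Rightarrow> bool" where
  "explicit_weights n m G f f' \<Lambda> \<longleftrightarrow> (\<forall>i<m. pa G i \<noteq> {} \<longrightarrow>
     (let l = l_index n G f f' i in
        vec_of_list (map (\<lambda>j. \<Lambda> $$ (i, j)) (pa_list G i)) =
        inverse (c_coeff n G f f' i l) \<cdot>\<^sub>v D_coeff n G f f' i l))"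

end

(* Write A and E for the matrices of parent columns of f and f' at a vertex i, and w and v for
the columns of i. The images of f and f' are orthogonal, so at f + eps f' the normal equations
are (A*A + d E*E) x = A*w + d E*v with d = |eps|^2, and A*A + d E*E is invertible for d > 0
because ker A and ker E meet in 0. By Cramer's rule the solution is N(d) / det(d), where N and det
are polynomials. Let l be the order of vanishing of det at 0. Comparing coefficients in
(A*A + d E*E) N(d) = det(d) (A*w + d E*v) shows that N also vanishes to order l: the lowest
non-zero coefficient of N of index k < l would be killed by A, and pairing the next coefficient
equation with it shows that E kills it too. Hence the limit is the quotient N_l / det_l of
coefficients, and the coefficient equation of index l says that it solves the normal equations of
A and w. Jacobi's formula identifies l! det_l and l! N_l with the coefficients of the theorem. *)
theory Submission
  imports Defs
begin

section \<open>Inner products and polynomial matrices\<close>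

text \<open>The likelihood splits over the vertices, because its summand at i involves only row i of
  \<open>\<Lambda>\<close> and the i-th variance. Each vertex thus poses a least squares problem,
  and the optimal variance is the mean squared residual. Variances must be positive, so an MLE
  exists exactly when no optimal residual is zero. This holds for every injective sample, as a
  residual is the image of a vector with entry 1 at i. Polynomials in a formal variable take the
  place of rank or eigenvalue arguments: d is real and positive, the derivatives of the explicit
  formula are taken over K, and both see the same coefficients. A zero residual of f makes a limit
  variance vanish. The limit is therefore built as a mere pair, and positivity is recovered from a
  given MLE of f. For part (b), orthogonal images make the squared residual of f + f' the sum of
  those of f and f', so equal variances amount to an exact fit of the column of f'.\<close>

lemma mult_conjugate_of_real:
  "x * conjugate x = of_real ((norm (x :: 'a :: real_or_complex))\<^sup>2)"
  by (simp add: mult_conjugate of_real_def)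

lemma of_real_norm_sq:
  "of_real (norm_sq v) = v \<bullet>c (v :: 'a :: real_or_complex vec)"
  unfolding norm_sq_def scalar_prod_def of_real_sum
  by (auto simp: mult_conjugate_of_real lessThan_atLeast0 intro!: sum.cong)

lemma norm_sq_nonneg: "0 \<le> norm_sq v"
  unfolding norm_sq_def by (auto intro!: sum_nonneg)

lemma norm_sq_eq_0_iff: "v \<in> carrier_vec k \<Longrightarrow> norm_sq v = 0 \<longleftrightarrow> v = 0\<^sub>v k"
  unfolding norm_sq_def by (subst sum_nonneg_eq_0_iff) (auto intro!: eq_vecI)

lemma cscalar_prod_swap:
  assumes "u \<in> carrier_vec k" "v \<in> carrier_vec k"
  shows "v \<bullet>c u = conjugate (u \<bullet>c (v :: 'a :: real_or_complex vec))"
  using assms by (metis carrier_vec_conjugate conjugate_conjugate_sprod conjugate_vec_sprod_comm conjugate_id)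

lemma norm_sq_add_orthogonal:
  assumes "u \<in> carrier_vec k" "v \<in> carrier_vec k" "u \<bullet>c (v :: 'a :: real_or_complex vec) = 0"
  shows "norm_sq (u + v) = norm_sq u + norm_sq v"
proof -
  have [simp]: "v \<bullet>c u = 0" using cscalar_prod_swap[OF assms(1,2)] assms(3) by simp
  have "(of_real (norm_sq (u + v)) :: 'a) = of_real (norm_sq u + norm_sq v)"
    unfolding of_real_add of_real_norm_sq using assms
    by (simp add: conjugate_add_vec[of _ k] add_scalar_prod_distrib[of _ k] scalar_prod_add_distrib[of _ k])
  thus ?thesis by (simp only: of_real_eq_iff)
qed

section \<open>Adjoints and Gram matrices\<close>

lemma dim_mat_adjoint [simp]:
  "dim_row (mat_adjoint A) = dim_col A" "dim_col (mat_adjoint A) = dim_row A"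
  unfolding mat_adjoint_def by auto

lemma mat_adjoint_carrier [simp]:
  "A \<in> carrier_mat r c \<Longrightarrow> mat_adjoint A \<in> carrier_mat c r"
  by auto

lemma mat_adjoint_index [simp]:
  assumes "i < dim_col A" "j < dim_row A"
  shows "mat_adjoint A $$ (i, j) = conjugate (A $$ (j, i))"
  using assms unfolding mat_adjoint_def by (auto simp: mat_of_rows_def)

lemma mat_adjoint_add:
  assumes "A \<in> carrier_mat r c" "B \<in> carrier_mat r c"
  shows "mat_adjoint (A + B) = mat_adjoint A + mat_adjoint B"
  using assms by (intro eq_matI) (auto simp: conjugate_dist_add)

lemma mat_adjoint_smult: "mat_adjoint (k \<cdot>\<^sub>m A) = conjugate k \<cdot>\<^sub>m mat_adjoint A"
  by (intro eq_matI) (auto simp: conjugate_dist_mul)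

lemma mat_adjoint_cscalar_prod:
  fixes A :: "'a :: real_or_complex mat"
  assumes A: "A \<in> carrier_mat r c" and x: "x \<in> carrier_vec c" and y: "y \<in> carrier_vec r"
  shows "(A *\<^sub>v x) \<bullet>c y = x \<bullet>c (mat_adjoint A *\<^sub>v y)"
proof -
  have "(A *\<^sub>v x) \<bullet>c y = (\<Sum>i<r. \<Sum>j<c. A $$ (i,j) * x $ j * conjugate (y $ i))"
    using assms by (auto simp: scalar_prod_def lessThan_atLeast0 sum_distrib_right intro!: sum.cong)
  also have "\<dots> = (\<Sum>j<c. \<Sum>i<r. A $$ (i,j) * x $ j * conjugate (y $ i))" by (rule sum.swap)
  also have "\<dots> = x \<bullet>c (mat_adjoint A *\<^sub>v y)"
    using assms
    by (auto simp: scalar_prod_def lessThan_atLeast0 sum_distrib_left sum_conjugate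
      conjugate_dist_mul ac_simps intro!: sum.cong)
  finally show ?thesis .
qed

lemma gram_carrier [simp]: "A \<in> carrier_mat r c \<Longrightarrow> gram A \<in> carrier_mat c c"
  unfolding gram_def by (metis mat_adjoint_carrier mult_carrier_mat)

lemma gram_mult_vec:
  assumes "A \<in> carrier_mat r c" "x \<in> carrier_vec c"
  shows "gram A *\<^sub>v x = mat_adjoint A *\<^sub>v (A *\<^sub>v x)"
  unfolding gram_def using assms assoc_mult_mat_vec[OF mat_adjoint_carrier[OF assms(1)] assms] by simp

lemma norm_sq_mult_mat_vec:
  assumes "A \<in> carrier_mat r c" "x \<in> carrier_vec c"
  shows "of_real (norm_sq (A *\<^sub>v x)) = x \<bullet>c (gram A *\<^sub>v x)"
  using assms by (simp add: of_real_norm_sq gram_mult_vec mat_adjoint_cscalar_prod[of _ r c])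

text \<open>The pairing in the hypothesis is |A x|^2. Asking for this pairing only, rather than for
  \<open>gram A\<close> to kill x, is what the coefficient comparison can supply for E.\<close>

lemma gram_mult_eq_0:
  fixes A :: "'a :: real_or_complex mat"
  assumes "A \<in> carrier_mat r c" "x \<in> carrier_vec c" "x \<bullet>c (gram A *\<^sub>v x) = 0"
  shows "A *\<^sub>v x = 0\<^sub>v r"
proof -
  have "(of_real (norm_sq (A *\<^sub>v x)) :: 'a) = 0"
    using norm_sq_mult_mat_vec[OF assms(1,2)] assms(3) by simp
  thus ?thesis using assms by (subst norm_sq_eq_0_iff[symmetric, of _ r]) auto
qed

section \<open>Jacobi's formula and derivatives of polynomial matrices\<close>

text \<open>The product rule in the Leibniz expansion gives a sum of determinants, the i-th having
  row i differentiated. Laplace expansion of that one along row i meets only cofactors of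
  \<open>M\<close> itself. With formal derivatives, reading off coefficients yields all higher
  derivatives at 0 at once.\<close>

lemma pderiv_det:
  fixes M :: "'a :: idom poly mat"
  assumes M: "M \<in> carrier_mat p p"
  shows "pderiv (det M) = (\<Sum>i<p. \<Sum>j<p. pderiv (M $$ (i, j)) * adj_mat M $$ (j, i))"
proof -
  let ?S = "{\<pi>. \<pi> permutes {0..<p}}"
  define R where "R i = mat p p (\<lambda>(k, j). if k = i then pderiv (M $$ (k, j)) else M $$ (k, j))" for i
  have R: "R i \<in> carrier_mat p p" for i unfolding R_def by simp
  have "pderiv (det M) = (\<Sum>\<pi>\<in>?S. signof \<pi> * pderiv (\<Prod>k = 0..<p. M $$ (k, \<pi> k)))"
    unfolding det_def'[OF M] pderiv_sum
    by (intro sum.cong refl) (auto simp: pderiv_mult sign_def pderiv_minus)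
  also have "\<dots> = (\<Sum>\<pi>\<in>?S. \<Sum>i = 0..<p. signof \<pi> * (\<Prod>k = 0..<p. R i $$ (k, \<pi> k)))"
  proof (intro sum.cong refl)
    fix \<pi> assume pi: "\<pi> \<in> ?S"
    hence lt: "k < p \<Longrightarrow> \<pi> k < p" for k using permutes_in_image[of \<pi> "{0..<p}" k] by (auto dest: permutes_in_image)
    have "(\<Prod>k = 0..<p. R i $$ (k, \<pi> k)) = (\<Prod>k\<in>{0..<p} - {i}. M $$ (k, \<pi> k)) * pderiv (M $$ (i, \<pi> i))"
      if "i < p" for i
      using that lt by (subst prod.remove[of _ i]) (auto simp: R_def intro!: prod.cong)
    thus "signof \<pi> * pderiv (\<Prod>k = 0..<p. M $$ (k, \<pi> k)) =
      (\<Sum>i = 0..<p. signof \<pi> * (\<Prod>k = 0..<p. R i $$ (k, \<pi> k)))"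
      unfolding pderiv_prod sum_distrib_left by (auto intro!: sum.cong)
  qed
  also have "\<dots> = (\<Sum>i = 0..<p. det (R i))"
    unfolding det_def'[OF R] by (rule sum.swap)
  also have "\<dots> = (\<Sum>i<p. \<Sum>j<p. pderiv (M $$ (i, j)) * adj_mat M $$ (j, i))"
    unfolding atLeast0LessThan
  proof (intro sum.cong refl)
    fix i assume "i \<in> {..<p}"
    hence i: "i < p" by simp
    have "cofactor (R i) i j = adj_mat M $$ (j, i)" if "j < p" for j
    proof -
      have "mat_delete (R i) i j = mat_delete M i j"
        using M i that by (intro eq_matI) (auto simp: mat_delete_def R_def)
      thus ?thesis using M i that by (simp add: adj_mat_def cofactor_def)
    qed
    thus "det (R i) = (\<Sum>j<p. pderiv (M $$ (i, j)) * adj_mat M $$ (j, i))"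
      unfolding laplace_expansion_row[OF R i] using i by (auto simp: R_def intro!: sum.cong)
  qed
  finally show ?thesis .
qed

lemma higher_deriv_poly:
  "(deriv ^^ l) (poly p) = poly ((pderiv ^^ l) (p :: 'a :: real_normed_field poly))"
proof (induction l)
  case (Suc l)
  have "deriv (poly q) = poly (pderiv q)" for q :: "'a poly"
    by (rule ext) (rule DERIV_imp_deriv, rule poly_DERIV)
  thus ?case using Suc by simp
qed simp

text \<open>The bridge from the analytic derivatives in \<open>mat_deriv0\<close> to coefficients:
  every entry of a curve in the explicit formula is polynomial in eps.\<close>

lemma higher_deriv_poly_0:
  "(deriv ^^ l) (poly p) 0 = fact l * coeff (p :: 'a :: real_normed_field poly) l"
  by (simp add: higher_deriv_poly poly_0_coeff_0 coeff_higher_pderiv pochhammer_fact)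

text \<open>Cofactors are polynomials in the entries, so evaluation at a point, being a ring
  homomorphism, passes through the adjugate.\<close>

lemma adj_mat_hom:
  assumes "comm_ring_hom h"
  shows "adj_mat (map_mat h M) = map_mat h (adj_mat M)"
proof -
  interpret comm_ring_hom h by fact
  have "mat_delete (map_mat h M) j i = map_mat h (mat_delete M j i)"
    if "i < dim_row M" "j < dim_col M" for i j
    using that by (intro eq_matI) (auto simp: mat_delete_def)
  thus ?thesis
    by (intro eq_matI) (auto simp: adj_mat_def cofactor_def hom_distribs)
qed

lemma poly_hom: "comm_ring_hom (\<lambda>q. poly q x)"
  by unfold_locales auto

section \<open>Regularised normal equations\<close>

text \<open>This has to be extracted from the class axiom: cancel x in x * conjugate x = |x|^2 = x *
  x.\<close>

lemma conjugate_of_real [simp]: "conjugate (of_real x :: 'a :: real_or_complex) = of_real x"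
proof (cases "x = 0")
  case False
  have "of_real x * conjugate (of_real x :: 'a) = of_real x * of_real x"
    unfolding mult_conjugate_of_real by (simp add: power2_eq_square)
  thus ?thesis using False by simp
qed simp

lemma smult_mat_mult_vec:
  fixes B :: "'b :: comm_ring_1 mat"
  assumes "B \<in> carrier_mat n k" "u \<in> carrier_vec k"
  shows "(c \<cdot>\<^sub>m B) *\<^sub>v u = c \<cdot>\<^sub>v (B *\<^sub>v u)"
  using assms by (intro eq_vecI) (auto simp: scalar_prod_def sum_distrib_left mult.assoc)

lemma zero_smult_vec: "0 \<cdot>\<^sub>v (u :: 'b :: comm_ring_1 vec) = 0\<^sub>v (dim_vec u)"
  by (intro eq_vecI) auto

lemma mult_mat_zero_vec: "B \<in> carrier_mat n k \<Longrightarrow> B *\<^sub>v 0\<^sub>v k = (0\<^sub>v n :: 'b :: comm_ring_1 vec)"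
  by (intro eq_vecI) auto

text \<open>The setting of minimising |w - A x|^2 + d |v - E x|^2 for d > 0. The row numbers
  \<open>r\<close> and \<open>s\<close> are kept apart so that E may also be an identity matrix,
  which later yields the existence of least squares solutions.\<close>

locale ridge_regression =
  fixes r s p :: nat and A E :: "'a :: real_or_complex mat" and w v :: "'a vec"
  assumes A: "A \<in> carrier_mat r p" and E: "E \<in> carrier_mat s p"
    and w: "w \<in> carrier_vec r" and v: "v \<in> carrier_vec s"
    and ker: "x \<in> carrier_vec p \<Longrightarrow> A *\<^sub>v x = 0\<^sub>v r \<Longrightarrow> E *\<^sub>v x = 0\<^sub>v s \<Longrightarrow> x = 0\<^sub>v p"
begin

abbreviation "a \<equiv> mat_adjoint A *\<^sub>v w"
abbreviation "b \<equiv> mat_adjoint E *\<^sub>v v"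

text \<open>The formal variable is evaluated at |eps|^2 for the limit and at eps itself for the
  derivatives in the explicit formula.\<close>

definition pencil :: "'a poly mat" where
  "pencil = mat p p (\<lambda>(i, j). [:gram A $$ (i, j), gram E $$ (i, j):])"

definition rhs :: "'a poly vec" where
  "rhs = vec p (\<lambda>i. [:a $ i, b $ i:])"

definition num :: "'a poly vec" where
  "num = adj_mat pencil *\<^sub>v rhs"

definition num_coeff :: "nat \<Rightarrow> 'a vec" where
  "num_coeff k = vec p (\<lambda>j. coeff (num $ j) k)"

definition ord :: nat where
  "ord = (LEAST l. coeff (det pencil) l \<noteq> 0)"

definition ridge_limit :: "'a vec" where
  "ridge_limit = inverse (coeff (det pencil) ord) \<cdot>\<^sub>v num_coeff ord"

lemma dims [simp]:
  "dim_row A = r" "dim_col A = p" "dim_row E = s" "dim_col E = p"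
  "dim_vec w = r" "dim_vec v = s"
  "dim_row (gram A) = p" "dim_col (gram A) = p" "dim_row (gram E) = p" "dim_col (gram E) = p"
  using A E w v by (auto simp: gram_def)

lemma gram_A [simp]: "gram A \<in> carrier_mat p p" and gram_E [simp]: "gram E \<in> carrier_mat p p"
  and a_carrier [simp]: "a \<in> carrier_vec p" and b_carrier [simp]: "b \<in> carrier_vec p"
  by (auto intro!: carrier_matI carrier_vecI)

lemma pencil_carrier [simp]: "pencil \<in> carrier_mat p p" "dim_row pencil = p" "dim_col pencil = p"
  and rhs_carrier [simp]: "rhs \<in> carrier_vec p"
  and num_coeff_carrier [simp]: "num_coeff k \<in> carrier_vec p"
  and ridge_limit_carrier [simp]: "ridge_limit \<in> carrier_vec p"
  unfolding pencil_def rhs_def num_coeff_def ridge_limit_def by auto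

lemma num_carrier [simp]: "num \<in> carrier_vec p"
  unfolding num_def using adj_mat(1)[OF pencil_carrier(1)] by auto

lemma poly_pencil: "map_mat (\<lambda>q. poly q x) pencil = gram A + x \<cdot>\<^sub>m gram E"
  by (intro eq_matI) (auto simp: pencil_def)

lemma poly_rhs: "map_vec (\<lambda>q. poly q x) rhs = a + x \<cdot>\<^sub>v b"
  using a_carrier b_carrier by (intro eq_vecI) (auto simp: rhs_def)

lemma poly_det_pencil: "poly (det pencil) x = det (gram A + x \<cdot>\<^sub>m gram E)"
  by (simp only: comm_ring_hom.hom_det[OF poly_hom, symmetric] poly_pencil)

lemma poly_adj_pencil: "map_mat (\<lambda>q. poly q x) (adj_mat pencil) = adj_mat (gram A + x \<cdot>\<^sub>m gram E)"
  using adj_mat_hom[OF poly_hom] poly_pencil by metis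

lemma poly_num: "map_vec (\<lambda>q. poly q x) num = adj_mat (gram A + x \<cdot>\<^sub>m gram E) *\<^sub>v (a + x \<cdot>\<^sub>v b)"
proof -
  have "semiring_hom (\<lambda>q. poly q x)" by unfold_locales auto
  thus ?thesis
    unfolding num_def poly_adj_pencil[symmetric] poly_rhs[symmetric]
    by (rule semiring_hom.mult_mat_vec_hom[OF _ adj_mat(1)[OF pencil_carrier(1)] rhs_carrier])
qed

text \<open>Pairing with x turns the equation into |A x|^2 + \<delta> |E x|^2 = 0, a sum of two
  non-negative terms.\<close>

lemma pencil_injective:
  assumes d: "0 < \<delta>" and x: "x \<in> carrier_vec p"
    and 0: "(gram A + of_real \<delta> \<cdot>\<^sub>m gram E) *\<^sub>v x = 0\<^sub>v p"
  shows "x = 0\<^sub>v p"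
proof -
  have "gram A *\<^sub>v x + of_real \<delta> \<cdot>\<^sub>v (gram E *\<^sub>v x) = 0\<^sub>v p"
    using 0 x by (simp add: add_mult_distrib_mat_vec[of _ p p] smult_mat_mult_vec[of _ p p])
  hence "x \<bullet>c (gram A *\<^sub>v x + of_real \<delta> \<cdot>\<^sub>v (gram E *\<^sub>v x)) = 0" using x by simp
  hence "x \<bullet>c (gram A *\<^sub>v x) + conjugate (of_real \<delta>) * (x \<bullet>c (gram E *\<^sub>v x)) = 0"
    using x mult_mat_vec_carrier[OF gram_A x] mult_mat_vec_carrier[OF gram_E x]
    by (simp add: conjugate_add_vec[of _ p] conjugate_smult_vec scalar_prod_add_distrib[of _ p])
  hence "(of_real (norm_sq (A *\<^sub>v x) + \<delta> * norm_sq (E *\<^sub>v x)) :: 'a) = of_real 0"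
    using norm_sq_mult_mat_vec[OF A x] norm_sq_mult_mat_vec[OF E x]
    by (simp add: conjugate_of_real)
  hence "norm_sq (A *\<^sub>v x) + \<delta> * norm_sq (E *\<^sub>v x) = 0" by (simp only: of_real_eq_iff)
  moreover have "0 \<le> \<delta> * norm_sq (E *\<^sub>v x)" using d norm_sq_nonneg[of "E *\<^sub>v x"] by simp
  ultimately have "norm_sq (A *\<^sub>v x) = 0" "\<delta> * norm_sq (E *\<^sub>v x) = 0"
    using norm_sq_nonneg[of "A *\<^sub>v x"] by linarith+
  hence "A *\<^sub>v x = 0\<^sub>v r" "E *\<^sub>v x = 0\<^sub>v s"
    using A E x d by (auto simp: norm_sq_eq_0_iff[of _ r] norm_sq_eq_0_iff[of _ s])
  thus ?thesis using ker x by blast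
qed

lemma det_pencil_nonzero: "0 < \<delta> \<Longrightarrow> poly (det pencil) (of_real \<delta>) \<noteq> 0"
  unfolding poly_det_pencil
  using det_0_iff_vec_prod_zero_field[of "gram A + of_real \<delta> \<cdot>\<^sub>m gram E" p] pencil_injective by auto

lemma det_pencil_neq_0: "det pencil \<noteq> 0"
  using det_pencil_nonzero[of 1] by auto

lemma coeff_det_ord: "coeff (det pencil) ord \<noteq> 0"
proof -
  have "\<exists>l. coeff (det pencil) l \<noteq> 0" using det_pencil_neq_0 leading_coeff_neq_0 by blast
  thus ?thesis unfolding ord_def by (rule LeastI_ex)
qed

lemma coeff_det_less_ord: "k < ord \<Longrightarrow> coeff (det pencil) k = 0"
  unfolding ord_def using not_less_Least by blast

lemma degree_det_pencil: "degree (det pencil) \<le> p"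
proof -
  have "degree (det pencil) \<le> 1 * p"
    by (rule degree_det_le[OF _ pencil_carrier(1)]) (simp add: pencil_def)
  thus ?thesis by simp
qed

text \<open>The entries of the pencil have degree at most 1, so its determinant has degree at most
  p. The first non-zero coefficient thus respects the bound built into
  \<open>l_index\<close>.\<close>

lemma ord_eq: "ord = (LEAST l. l \<le> p \<and> coeff (det pencil) l \<noteq> 0)"
proof -
  have "ord \<le> p" using coeff_det_ord degree_det_pencil le_degree order_trans by blast
  thus ?thesis using coeff_det_ord coeff_det_less_ord
    by (intro Least_equality[symmetric]) (auto simp: not_less[symmetric])
qed

section \<open>Coefficient comparison and the limit of the solutions\<close>

lemma pencil_num: "pencil *\<^sub>v num = det pencil \<cdot>\<^sub>v rhs"
proof -
  have "pencil *\<^sub>v num = (pencil * adj_mat pencil) *\<^sub>v rhs"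
    unfolding num_def using adj_mat(1)[OF pencil_carrier(1)]
    by (simp add: assoc_mult_mat_vec[of _ p p _ p])
  also have "\<dots> = det pencil \<cdot>\<^sub>v rhs"
    unfolding adj_mat(2)[OF pencil_carrier(1)]
    by (simp add: smult_mat_mult_vec[of _ p p])
  finally show ?thesis .
qed

lemma pencil_num_index:
  assumes "i < p"
  shows "(\<Sum>j<p. [:gram A $$ (i, j), gram E $$ (i, j):] * num $ j) = det pencil * [:a $ i, b $ i:]"
proof -
  have "(pencil *\<^sub>v num) $ i = (det pencil \<cdot>\<^sub>v rhs) $ i" by (simp only: pencil_num)
  thus ?thesis using assms num_carrier
    by (simp add: scalar_prod_def pencil_def rhs_def lessThan_atLeast0)
qed

lemma num_coeff_0: "gram A *\<^sub>v num_coeff 0 = coeff (det pencil) 0 \<cdot>\<^sub>v a"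
proof (rule eq_vecI)
  fix i assume "i < dim_vec (coeff (det pencil) 0 \<cdot>\<^sub>v a)"
  hence i: "i < p" using a_carrier by auto
  show "(gram A *\<^sub>v num_coeff 0) $ i = (coeff (det pencil) 0 \<cdot>\<^sub>v a) $ i"
    using arg_cong[OF pencil_num_index[OF i], of "\<lambda>q. coeff q 0"] i a_carrier
    by (simp add: coeff_sum scalar_prod_def num_coeff_def lessThan_atLeast0 coeff_mult_0 mult.commute del: mult_pCons_left mult_pCons_right)
qed (use a_carrier in auto)

lemma num_coeff_Suc:
  "gram A *\<^sub>v num_coeff (Suc k) + gram E *\<^sub>v num_coeff k =
   coeff (det pencil) (Suc k) \<cdot>\<^sub>v a + coeff (det pencil) k \<cdot>\<^sub>v b" (is "?L = ?R")
proof (rule eq_vecI)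
  fix i assume "i < dim_vec ?R"
  hence i: "i < p" using a_carrier b_carrier by auto
  show "?L $ i = ?R $ i"
    using arg_cong[OF pencil_num_index[OF i], of "\<lambda>q. coeff q (Suc k)"] i a_carrier b_carrier
    by (simp add: coeff_sum scalar_prod_def num_coeff_def lessThan_atLeast0 sum.distrib mult.commute)
qed (use b_carrier in auto)

lemma num_coeff_eq_0: "k < ord \<Longrightarrow> num_coeff k = 0\<^sub>v p"
proof (induction k)
  \<comment> \<open>Both cases of the induction share this argument; the previous coefficient
    matters only for showing that \<open>gram A\<close> kills \<open>num_coeff k\<close>.\<close>
  have step: "num_coeff k = 0\<^sub>v p" if k: "k < ord" and 0: "gram A *\<^sub>v num_coeff k = 0\<^sub>v p" for k
  proof -
    let ?x = "num_coeff k" and ?y = "num_coeff (Suc k)"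
    have A0: "A *\<^sub>v ?x = 0\<^sub>v r" by (rule gram_mult_eq_0[OF A]) (use 0 in auto)
    have "gram A *\<^sub>v ?y + gram E *\<^sub>v ?x = coeff (det pencil) (Suc k) \<cdot>\<^sub>v a"
      using coeff_det_less_ord[OF k] num_coeff_Suc[of k] by (simp add: zero_smult_vec)
    hence "(gram A *\<^sub>v ?y + gram E *\<^sub>v ?x) \<bullet>c ?x = (coeff (det pencil) (Suc k) \<cdot>\<^sub>v a) \<bullet>c ?x"
      by (simp only:)
    \<comment> \<open>The determinant coefficient of index \<open>Suc k\<close> may be non-zero,
      namely for \<open>Suc k = ord\<close>. Its term disappears all the same: \<open>a\<close> and
      the image of \<open>?y\<close> under \<open>gram A\<close> lie in the image of
      \<open>mat_adjoint A\<close>, which is orthogonal to the kernel of A.\<close>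
    moreover have "(mat_adjoint A *\<^sub>v z) \<bullet>c ?x = 0" if z: "z \<in> carrier_vec r" for z
    proof -
      have "?x \<bullet>c (mat_adjoint A *\<^sub>v z) = 0"
        using mat_adjoint_cscalar_prod[OF A, of ?x z] z A0 by simp
      thus ?thesis
        using cscalar_prod_swap[of ?x p "mat_adjoint A *\<^sub>v z"] mult_mat_vec_carrier[OF mat_adjoint_carrier[OF A] z] by simp
    qed
    note this[OF w] this[OF mult_mat_vec_carrier[OF A num_coeff_carrier, of "Suc k"]]
    ultimately have "(gram E *\<^sub>v ?x) \<bullet>c ?x = 0"
      using mult_mat_vec_carrier[OF gram_A num_coeff_carrier, of "Suc k"]
        mult_mat_vec_carrier[OF gram_E num_coeff_carrier, of k]
      by (simp add: add_scalar_prod_distrib[of _ p] gram_mult_vec[OF A]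
        smult_scalar_prod_distrib[OF a_carrier carrier_vec_conjugate[OF num_coeff_carrier]])
    hence "?x \<bullet>c (gram E *\<^sub>v ?x) = 0"
      using cscalar_prod_swap[OF mult_mat_vec_carrier[OF gram_E num_coeff_carrier] num_coeff_carrier] by simp
    hence "E *\<^sub>v ?x = 0\<^sub>v s" by (intro gram_mult_eq_0[OF E]) auto
    thus ?thesis using A0 ker by auto
  qed
  {
    case 0
    thus ?case using num_coeff_0 coeff_det_less_ord[of 0] by (intro step) (auto simp: zero_smult_vec)
  next
    case (Suc k)
    thus ?case using num_coeff_Suc[of k] coeff_det_less_ord[of "Suc k"] coeff_det_less_ord[of k]
      mult_mat_vec_carrier[OF gram_A num_coeff_carrier, of "Suc k"]
      by (intro step) (auto simp: zero_smult_vec mult_mat_zero_vec[of _ p p] simp del: mult_mat_vec_carrier)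
  }
qed

text \<open>In the coefficient equation of index \<open>ord\<close> the terms of index
  \<open>ord - 1\<close> are zero on both sides. For \<open>ord = 0\<close> there are no such terms,
  hence the case distinction.\<close>

lemma gram_ridge_limit: "gram A *\<^sub>v ridge_limit = a"
proof -
  have "gram A *\<^sub>v num_coeff ord = coeff (det pencil) ord \<cdot>\<^sub>v a"
  proof (cases ord)
    case (Suc k)
    thus ?thesis using num_coeff_Suc[of k] num_coeff_eq_0[of k] coeff_det_less_ord[of k]
      mult_mat_vec_carrier[OF gram_A num_coeff_carrier, of "Suc k"]
      by (auto simp: zero_smult_vec mult_mat_zero_vec[of _ p p] simp del: mult_mat_vec_carrier)
  qed (use num_coeff_0 in simp)
  thus ?thesis
    unfolding ridge_limit_def using coeff_det_ord
    by (simp add: mult_mat_vec[of _ p p] smult_smult_assoc)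
qed

text \<open>Cramer's rule with the determinant multiplied out, hence valid for every \<delta>, also
  at zeros of the determinant.\<close>

lemma ridge_solution:
  assumes x: "x \<in> carrier_vec p" and eq: "(gram A + \<delta> \<cdot>\<^sub>m gram E) *\<^sub>v x = a + \<delta> \<cdot>\<^sub>v b"
    and j: "j < p"
  shows "poly (det pencil) \<delta> * x $ j = poly (num $ j) \<delta>"
proof -
  let ?C = "gram A + \<delta> \<cdot>\<^sub>m gram E"
  have C: "?C \<in> carrier_mat p p" by simp
  have "map_vec (\<lambda>q. poly q \<delta>) num = (adj_mat ?C * ?C) *\<^sub>v x"
    unfolding poly_num eq[symmetric] using assoc_mult_mat_vec[OF adj_mat(1)[OF C] C x] by simp
  also have "\<dots> = poly (det pencil) \<delta> \<cdot>\<^sub>v x"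
    unfolding adj_mat(3)[OF C] poly_det_pencil using x
    by (simp add: smult_mat_mult_vec[of _ p p])
  finally have "map_vec (\<lambda>q. poly q \<delta>) num $ j = (poly (det pencil) \<delta> \<cdot>\<^sub>v x) $ j" by simp
  thus ?thesis using x j num_carrier by simp
qed

lemma tendsto_ridge_limit:
  assumes x: "\<And>\<epsilon>. \<epsilon> \<noteq> 0 \<Longrightarrow> x \<epsilon> \<in> carrier_vec p"
    and eq: "\<And>\<epsilon>. \<epsilon> \<noteq> 0 \<Longrightarrow> (gram A + of_real ((norm \<epsilon>)\<^sup>2) \<cdot>\<^sub>m gram E) *\<^sub>v x \<epsilon> = a + of_real ((norm \<epsilon>)\<^sup>2) \<cdot>\<^sub>v b"
    and j: "j < p"
  shows "((\<lambda>\<epsilon> :: 'a. x \<epsilon> $ j) \<longlongrightarrow> ridge_limit $ j) (at 0)"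
proof -
  \<comment> \<open>After cancelling the common power of the variable, the denominator
    \<open>d\<close> is non-zero at 0, so the quotient is continuous there and its value is the
    quotient of the coefficients of index \<open>ord\<close>.\<close>
  have "monom 1 ord dvd det pencil" "monom 1 ord dvd num $ j"
    using coeff_det_less_ord arg_cong[OF num_coeff_eq_0, of _ "\<lambda>u. u $ j"] j
    by (auto simp: monom_1_dvd_iff' num_coeff_def)
  then obtain d q where d: "det pencil = monom 1 ord * d" and q: "num $ j = monom 1 ord * q"
    by (auto elim!: dvdE)
  have c: "coeff (det pencil) ord = coeff d 0" "coeff (num $ j) ord = coeff q 0"
    unfolding d q by (simp_all add: coeff_monom_mult)
  have "((\<lambda>\<epsilon> :: 'a. of_real ((norm \<epsilon>)\<^sup>2) :: 'a) \<longlongrightarrow> of_real ((norm (0 :: 'a))\<^sup>2)) (at 0)"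
    by (intro tendsto_intros)
  hence "((\<lambda>\<epsilon> :: 'a. of_real ((norm \<epsilon>)\<^sup>2) :: 'a) \<longlongrightarrow> 0) (at 0)" by simp
  hence "((\<lambda>\<epsilon> :: 'a. poly q (of_real ((norm \<epsilon>)\<^sup>2)) / poly d (of_real ((norm \<epsilon>)\<^sup>2))) \<longlongrightarrow> poly q 0 / poly d 0) (at 0)"
    using coeff_det_ord unfolding c by (intro tendsto_intros) (auto simp: poly_0_coeff_0)
  moreover have "poly q 0 / poly d 0 = ridge_limit $ j"
    using j c by (simp add: ridge_limit_def num_coeff_def poly_0_coeff_0 field_simps)
  moreover have "x \<epsilon> $ j = poly q (of_real ((norm \<epsilon>)\<^sup>2)) / poly d (of_real ((norm \<epsilon>)\<^sup>2))" if "\<epsilon> \<noteq> 0" for \<epsilon> :: 'a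
    using ridge_solution[OF x[OF that] eq[OF that] j] det_pencil_nonzero[of "(norm \<epsilon>)\<^sup>2"] that
    unfolding d q by (simp add: field_simps)
  ultimately show ?thesis
    by (auto intro: Lim_transform_eventually simp: eventually_at_filter)
qed


section \<open>Derivatives of the adjugate as polynomial coefficients\<close>

lemma mat_deriv0_adj:
  assumes "i < p" "j < p"
  shows "mat_deriv0 l (\<lambda>\<epsilon>. adj_mat (gram A + \<epsilon> \<cdot>\<^sub>m gram E)) $$ (i, j) =
    fact l * coeff (adj_mat pencil $$ (i, j)) l"
proof -
  have "adj_mat (gram A + x \<cdot>\<^sub>m gram E) $$ (i, j) = poly (adj_mat pencil $$ (i, j)) x" for x
    using assms adj_mat(1)[OF pencil_carrier(1)] unfolding poly_adj_pencil[symmetric] by simp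
  thus ?thesis
    using assms adj_mat(1)[of "gram A + 0 \<cdot>\<^sub>m gram E" p]
    by (simp add: mat_deriv0_def higher_deriv_poly_0)
qed

lemma mat_deriv0_adj_carrier [simp]:
  "mat_deriv0 l (\<lambda>\<epsilon>. adj_mat (gram A + \<epsilon> \<cdot>\<^sub>m gram E)) \<in> carrier_mat p p"
  "dim_row (mat_deriv0 l (\<lambda>\<epsilon>. adj_mat (gram A + \<epsilon> \<cdot>\<^sub>m gram E))) = p"
  "dim_col (mat_deriv0 l (\<lambda>\<epsilon>. adj_mat (gram A + \<epsilon> \<cdot>\<^sub>m gram E))) = p"
  using adj_mat(1)[of "gram A + 0 \<cdot>\<^sub>m gram E" p] by (simp_all add: mat_deriv0_def)

text \<open>Coefficient k of Jacobi's formula: the pencil is linear with derivative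
  \<open>gram E\<close>, so the trace is k! times coefficient k of the derivative of the
  determinant.\<close>

lemma mat_trace_deriv_adj:
  "mat_trace (mat_deriv0 k (\<lambda>\<epsilon>. adj_mat (gram A + \<epsilon> \<cdot>\<^sub>m gram E)) * gram E) =
   fact (Suc k) * coeff (det pencil) (Suc k)"
proof -
  let ?M = "mat_deriv0 k (\<lambda>\<epsilon>. adj_mat (gram A + \<epsilon> \<cdot>\<^sub>m gram E))"
  have "mat_trace (?M * gram E) = (\<Sum>i<p. \<Sum>j<p. ?M $$ (i, j) * gram E $$ (j, i))"
    by (auto simp: mat_trace_def scalar_prod_def lessThan_atLeast0 intro!: sum.cong)
  also have "\<dots> = fact k * (\<Sum>i<p. \<Sum>j<p. coeff (pderiv (pencil $$ (j, i)) * adj_mat pencil $$ (i, j)) k)"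
    by (auto simp: mat_deriv0_adj sum_distrib_left pencil_def pderiv_pCons intro!: sum.cong)
  also have "\<dots> = fact k * coeff (pderiv (det pencil)) k"
    unfolding pderiv_det[OF pencil_carrier(1)] coeff_sum by (subst sum.swap) simp
  finally show ?thesis by (simp add: coeff_pderiv algebra_simps)
qed

text \<open>The Leibniz rule for the adjugate applied to \<open>rhs\<close>; only two terms occur
  because \<open>rhs\<close> is linear in the variable.\<close>

lemma num_coeff_Leibniz:
  "mat_deriv0 l (\<lambda>\<epsilon>. adj_mat (gram A + \<epsilon> \<cdot>\<^sub>m gram E)) *\<^sub>v a +
   of_nat l \<cdot>\<^sub>v (mat_deriv0 (l - 1) (\<lambda>\<epsilon>. adj_mat (gram A + \<epsilon> \<cdot>\<^sub>m gram E)) *\<^sub>v b) =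
   fact l \<cdot>\<^sub>v num_coeff l" (is "?M l *\<^sub>v a + _ = _")
proof (rule eq_vecI)
  fix i assume "i < dim_vec (fact l \<cdot>\<^sub>v num_coeff l)"
  hence i: "i < p" by (simp add: num_coeff_def)
  let ?q = "\<lambda>j. adj_mat pencil $$ (i, j)"
  have mv: "(?M k *\<^sub>v u) $ i = (\<Sum>j<p. fact k * coeff (?q j) k * u $ j)" if "u \<in> carrier_vec p" for k u
    using that i
    by (auto simp: scalar_prod_def lessThan_atLeast0 mat_deriv0_adj intro!: sum.cong)
  have "num $ i = (\<Sum>j<p. ?q j * [:a $ j, b $ j:])"
    unfolding num_def using i adj_mat(1)[OF pencil_carrier(1)]
    by (auto simp: scalar_prod_def lessThan_atLeast0 rhs_def simp del: mult_pCons_right intro!: sum.cong)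
  hence "coeff (num $ i) l = (\<Sum>j<p. coeff (?q j) l * a $ j + (if l = 0 then 0 else coeff (?q j) (l - 1) * b $ j))"
    by (cases l) (auto simp: coeff_sum mult.commute coeff_pCons intro!: sum.cong)
  \<comment> \<open>At \<open>l = 0\<close> the truncated difference \<open>l - 1\<close> is again
    0, and the factor \<open>of_nat l\<close> removes that term.\<close>
  moreover have "of_nat l * fact (l - 1) = (if l = 0 then 0 else fact l :: 'a)"
    by (cases l) auto
  hence "of_nat l * (fact (l - 1) * x * y) = (if l = 0 then 0 else fact l * (x * y))" for x y :: 'a
    by (auto simp flip: mult.assoc)
  ultimately show "(?M l *\<^sub>v a + of_nat l \<cdot>\<^sub>v (?M (l - 1) *\<^sub>v b)) $ i = (fact l \<cdot>\<^sub>v num_coeff l) $ i"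
    using i mv[OF a_carrier, of l] mv[OF b_carrier, of "l - 1"] mat_deriv0_adj_carrier(1)[of "l - 1"]
      mat_deriv0_adj_carrier(1)[of l]
    by (simp add: num_coeff_def sum_distrib_left distrib_left sum.distrib mult.assoc del: index_mult_mat_vec)
      (auto intro!: sum.cong)
qed (use mat_deriv0_adj_carrier(1)[of "l-1"] in \<open>auto simp: num_coeff_def\<close>)

end

section \<open>Least squares and orthogonal projections\<close>

text \<open>The normal equations, not minimality, serve as the definition because they are what the
  limit is known to solve. Minimality is recovered in \<open>least_squares_iff_min\<close>.\<close>

definition least_squares :: "'a :: real_or_complex mat \<Rightarrow> 'a vec \<Rightarrow> 'a vec \<Rightarrow> bool" where
  "least_squares A w x \<longleftrightarrow>
     x \<in> carrier_vec (dim_col A) \<and> mat_adjoint A *\<^sub>v (w - A *\<^sub>v x) = 0\<^sub>v (dim_col A)"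

lemma mult_mat_vec_diff:
  fixes A :: "'b :: comm_ring_1 mat"
  assumes "A \<in> carrier_mat r c" "x \<in> carrier_vec c" "y \<in> carrier_vec c"
  shows "A *\<^sub>v (x - y) = A *\<^sub>v x - A *\<^sub>v y"
  using assms by (intro eq_vecI) (auto simp: scalar_prod_def algebra_simps sum_subtractf)

lemma minus_eq_zero_vec_iff:
  "u \<in> carrier_vec k \<Longrightarrow> y \<in> carrier_vec k \<Longrightarrow> u - y = (0\<^sub>v k :: 'b :: ab_group_add vec) \<longleftrightarrow> u = y"
  by (auto simp: vec_eq_iff)

lemma least_squares_iff_gram:
  assumes "A \<in> carrier_mat r c" "w \<in> carrier_vec r"
  shows "least_squares A w x \<longleftrightarrow> x \<in> carrier_vec c \<and> gram A *\<^sub>v x = mat_adjoint A *\<^sub>v w"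
proof (cases "x \<in> carrier_vec c")
  case True
  have Ac: "mat_adjoint A \<in> carrier_mat c r" and Ax: "A *\<^sub>v x \<in> carrier_vec r" using assms True by auto
  have "mat_adjoint A *\<^sub>v (w - A *\<^sub>v x) = mat_adjoint A *\<^sub>v w - gram A *\<^sub>v x"
    unfolding mult_mat_vec_diff[OF Ac assms(2) Ax] gram_mult_vec[OF assms(1) True] ..
  moreover have "mat_adjoint A *\<^sub>v w - gram A *\<^sub>v x = 0\<^sub>v c \<longleftrightarrow> mat_adjoint A *\<^sub>v w = gram A *\<^sub>v x"
    by (rule minus_eq_zero_vec_iff[OF mult_mat_vec_carrier[OF Ac assms(2)]
      mult_mat_vec_carrier[OF gram_carrier[OF assms(1)] True]])
  ultimately show ?thesis
    using True carrier_matD(2)[OF assms(1)] by (simp only: least_squares_def) metis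
qed (use assms in \<open>auto simp: least_squares_def\<close>)

text \<open>For the converse take x to be \<open>mat_adjoint A\<close> applied to y: the pairing
  then becomes the squared norm of x.\<close>

lemma mat_adjoint_eq_0_iff:
  fixes A :: "'a :: real_or_complex mat"
  assumes A: "A \<in> carrier_mat r c" and y: "y \<in> carrier_vec r"
  shows "mat_adjoint A *\<^sub>v y = 0\<^sub>v c \<longleftrightarrow> (\<forall>x\<in>carrier_vec c. (A *\<^sub>v x) \<bullet>c y = 0)"
proof
  let ?z = "mat_adjoint A *\<^sub>v y"
  have z: "?z \<in> carrier_vec c" by (rule mult_mat_vec_carrier[OF mat_adjoint_carrier[OF A] y])
  assume "\<forall>x\<in>carrier_vec c. (A *\<^sub>v x) \<bullet>c y = 0"
  hence "?z \<bullet>c ?z = 0" using mat_adjoint_cscalar_prod[OF A z y] z by simp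
  hence "(of_real (norm_sq ?z) :: 'a) = 0" unfolding of_real_norm_sq .
  thus "?z = 0\<^sub>v c" using norm_sq_eq_0_iff[OF z] by simp
qed (use mat_adjoint_cscalar_prod[OF A _ y] in simp)

text \<open>Pythagoras for w - A y = (w - A x) + A (x - y), whose first summand is orthogonal to the
  image of A.\<close>

lemma norm_sq_least_squares:
  assumes A: "A \<in> carrier_mat r c" and w: "w \<in> carrier_vec r"
    and x: "least_squares A w x" and y: "y \<in> carrier_vec c"
  shows "norm_sq (w - A *\<^sub>v y) = norm_sq (w - A *\<^sub>v x) + norm_sq (A *\<^sub>v (x - y))"
proof -
  have xc: "x \<in> carrier_vec c" and 0: "mat_adjoint A *\<^sub>v (w - A *\<^sub>v x) = 0\<^sub>v c"
    using x A by (auto simp: least_squares_def)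
  have wx: "w - A *\<^sub>v x \<in> carrier_vec r" "A *\<^sub>v (x - y) \<in> carrier_vec r" using A w xc y by auto
  have "(A *\<^sub>v (x - y)) \<bullet>c (w - A *\<^sub>v x) = 0"
    using 0 mat_adjoint_eq_0_iff[OF A wx(1)] xc y by auto
  hence "(w - A *\<^sub>v x) \<bullet>c (A *\<^sub>v (x - y)) = 0"
    using cscalar_prod_swap[OF wx(2,1)] by simp
  moreover have "w - A *\<^sub>v y = (w - A *\<^sub>v x) + A *\<^sub>v (x - y)"
    unfolding mult_mat_vec_diff[OF A xc y] using A w xc y by auto
  ultimately show ?thesis using norm_sq_add_orthogonal[OF wx] by simp
qed

text \<open>Tikhonov regularisation: with the identity as E and 0 as v the kernels meet in 0
  whatever A is, and the limit solves the normal equations of A. No rank argument is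
  involved.\<close>

lemma least_squares_exists:
  fixes A :: "'a :: real_or_complex mat"
  assumes A: "A \<in> carrier_mat r c" and w: "w \<in> carrier_vec r"
  shows "\<exists>x. least_squares A w x"
proof -
  interpret ridge_regression r c c A "1\<^sub>m c" w "0\<^sub>v c"
    using A w by unfold_locales auto
  show ?thesis
    using gram_ridge_limit ridge_limit_carrier least_squares_iff_gram[OF A w] by blast
qed

text \<open>Pythagoras from x to y and from y to x forces both correction terms to be zero. The
  solutions themselves may differ when A has a kernel.\<close>

lemma least_squares_mult_unique:
  assumes A: "A \<in> carrier_mat r c" and w: "w \<in> carrier_vec r"
    and x: "least_squares A w x" and y: "least_squares A w y"
  shows "A *\<^sub>v x = A *\<^sub>v y"
proof -
  have c: "x \<in> carrier_vec c" "y \<in> carrier_vec c" using x y A by (auto simp: least_squares_def)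
  have "norm_sq (A *\<^sub>v (x - y)) = 0"
    using norm_sq_least_squares[OF A w x c(2)] norm_sq_least_squares[OF A w y c(1)]
      norm_sq_nonneg[of "A *\<^sub>v (x - y)"] norm_sq_nonneg[of "A *\<^sub>v (y - x)"] by linarith
  hence "A *\<^sub>v (x - y) = 0\<^sub>v r" using norm_sq_eq_0_iff[of "A *\<^sub>v (x - y)" r] A c by auto
  thus ?thesis using mult_mat_vec_diff[OF A c] minus_eq_zero_vec_iff[of "A *\<^sub>v x" r] A c by auto
qed

text \<open>For the converse, compare a minimiser with some solution of the normal equations:
  Pythagoras forces equal fitted vectors, and the equations depend on the fitted vector
  only.\<close>

lemma least_squares_iff_min:
  assumes A: "A \<in> carrier_mat r c" and w: "w \<in> carrier_vec r"
  shows "least_squares A w x \<longleftrightarrow>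
    x \<in> carrier_vec c \<and> (\<forall>y\<in>carrier_vec c. norm_sq (w - A *\<^sub>v x) \<le> norm_sq (w - A *\<^sub>v y))"
proof (safe)
  assume x: "least_squares A w x"
  thus "x \<in> carrier_vec c" using A by (auto simp: least_squares_def)
  fix y :: "'a vec" assume "y \<in> carrier_vec c"
  thus "norm_sq (w - A *\<^sub>v x) \<le> norm_sq (w - A *\<^sub>v y)"
    using norm_sq_least_squares[OF A w x] norm_sq_nonneg[of "A *\<^sub>v (x - y)"] by simp
next
  assume x: "x \<in> carrier_vec c" and min: "\<forall>y\<in>carrier_vec c. norm_sq (w - A *\<^sub>v x) \<le> norm_sq (w - A *\<^sub>v y)"
  obtain y where y: "least_squares A w y" using least_squares_exists[OF A w] by blast
  hence yc: "y \<in> carrier_vec c" using A by (auto simp: least_squares_def)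
  have "norm_sq (A *\<^sub>v (y - x)) \<le> 0"
    using norm_sq_least_squares[OF A w y x] min yc by force
  hence "A *\<^sub>v (y - x) = 0\<^sub>v r"
    using norm_sq_eq_0_iff[of "A *\<^sub>v (y - x)" r] norm_sq_nonneg[of "A *\<^sub>v (y - x)"] A x yc by auto
  hence "A *\<^sub>v y = A *\<^sub>v x"
    using mult_mat_vec_diff[OF A yc x] minus_eq_zero_vec_iff[of "A *\<^sub>v y" r] A x yc by auto
  thus "least_squares A w x" using x y A by (auto simp: least_squares_def)
qed

lemma least_squares_unique:
  assumes A: "A \<in> carrier_mat r c" and w: "w \<in> carrier_vec r"
    and inj: "\<And>x. x \<in> carrier_vec c \<Longrightarrow> A *\<^sub>v x = 0\<^sub>v r \<Longrightarrow> x = 0\<^sub>v c"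
    and x: "least_squares A w x" and y: "least_squares A w y"
  shows "x = y"
proof -
  have c: "x \<in> carrier_vec c" "y \<in> carrier_vec c" using x y A by (auto simp: least_squares_def)
  have "A *\<^sub>v (x - y) = 0\<^sub>v r"
    using least_squares_mult_unique[OF A w x y] mult_mat_vec_diff[OF A c] A c by auto
  hence "x - y = 0\<^sub>v c" using inj c by auto
  thus ?thesis using minus_eq_zero_vec_iff[OF c] by simp
qed

section \<open>Orthogonal projection onto a column span\<close>

lemma vspan_cols:
  assumes "A \<in> carrier_mat n c"
  shows "vspan n (set (cols A)) = mat_image (A :: 'a :: real_or_complex mat)"
proof -
  interpret vec_space "TYPE('a)" n .
  show ?thesis
    using col_space_eq[OF assms] assms unfolding col_space_def mat_image_def by auto
qed

text \<open>A vector of the span has the form A y, and w - A y is orthogonal to the span exactly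
  when y solves the normal equations. Uniqueness in the definite description is uniqueness of the
  fitted vector.\<close>

lemma orth_proj_cols:
  assumes A: "A \<in> carrier_mat n c" and w: "w \<in> carrier_vec n" and x: "least_squares A w x"
  shows "orth_proj n (set (cols A)) w = A *\<^sub>v x"
proof -
  have proj: "w - A *\<^sub>v y \<in> orth_compl n (mat_image A) \<longleftrightarrow> least_squares A w y" if y: "y \<in> carrier_vec c" for y
  proof -
    have wy: "w - A *\<^sub>v y \<in> carrier_vec n" using A w y by auto
    have "(\<forall>z\<in>mat_image A. (w - A *\<^sub>v y) \<bullet>c z = 0) \<longleftrightarrow> (\<forall>z\<in>carrier_vec c. (A *\<^sub>v z) \<bullet>c (w - A *\<^sub>v y) = 0)"
      using A wy cscalar_prod_swap[OF wy mult_mat_vec_carrier[OF A]] cscalar_prod_swap[OF mult_mat_vec_carrier[OF A] wy]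
      by (auto simp: mat_image_def)
    thus ?thesis
      using A y wy by (auto simp: orth_compl_def least_squares_def mat_adjoint_eq_0_iff[OF A wy])
  qed
  have xc: "x \<in> carrier_vec c" using x A by (auto simp: least_squares_def)
  show ?thesis
    unfolding orth_proj_def vspan_cols[OF A]
  proof (rule the_equality)
    show "A *\<^sub>v x \<in> mat_image A \<and> w - A *\<^sub>v x \<in> orth_compl n (mat_image A)"
      using proj[OF xc] x xc A by (auto simp: mat_image_def)
  next
    fix u assume "u \<in> mat_image A \<and> w - u \<in> orth_compl n (mat_image A)"
    then obtain y where "u = A *\<^sub>v y" "y \<in> carrier_vec c" "w - A *\<^sub>v y \<in> orth_compl n (mat_image A)"
      using A by (auto simp: mat_image_def)
    thus "u = A *\<^sub>v x" using proj least_squares_mult_unique[OF A w _ x] by blast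
  qed
qed

text \<open>At \<open>R = 0\<close> both sides are false, since the infimum is not attained and \<open>\<omega> > 0\<close>.\<close>

lemma log_plus_ratio_min_iff:
  fixes R \<omega> k :: real
  assumes k: "0 < k" and w: "0 < \<omega>" and R: "0 \<le> R"
  shows "(\<forall>\<omega>'>0. ln \<omega> + 1 / (k * \<omega>) * R \<le> ln \<omega>' + 1 / (k * \<omega>') * R) \<longleftrightarrow> \<omega> = R / k"
proof
  assume min: "\<forall>\<omega>'>0. ln \<omega> + 1 / (k * \<omega>) * R \<le> ln \<omega>' + 1 / (k * \<omega>') * R"
  show "\<omega> = R / k"
  proof (cases "R = 0")
    case True
    from min[rule_format, of "\<omega> / 2"] w have "ln \<omega> \<le> ln (\<omega> / 2)" by (simp add: True)
    thus ?thesis using w by simp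
  next
    case False
    hence R: "0 < R" using R by simp
    \<comment> \<open>The ratio of the stationary variance R / k to the given one. In terms of t the
      comparison reads t - 1 \<le> ln t, while ln t \<le> t - 1 always holds, with equality only at
      t = 1.\<close>
    let ?t = "R / k / \<omega>"
    from min[rule_format, of "R / k"] R k have "ln \<omega> + ?t \<le> ln (R / k) + 1" by simp
    moreover have "ln ?t = ln (R / k) - ln \<omega>" using R k w by (subst ln_div) auto
    ultimately have "?t - 1 \<le> ln ?t" by simp
    moreover have "ln ?t \<le> ?t - 1" by (rule ln_le_minus_one) (use R k w in auto)
    ultimately have "?t = 1" using R k w by (intro ln_eq_minus_one) auto
    thus ?thesis using w k by (simp add: field_simps)
  qed
next
  assume eq: "\<omega> = R / k"
  hence R: "0 < R" using w k by (simp add: zero_less_divide_iff)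
  show "\<forall>\<omega>'>0. ln \<omega> + 1 / (k * \<omega>) * R \<le> ln \<omega>' + 1 / (k * \<omega>') * R"
  proof (intro allI impI)
    fix \<omega>' :: real assume w': "0 < \<omega>'"
    let ?t = "R / k / \<omega>'"
    have "ln ?t = ln (R / k) - ln \<omega>'" using R k w' by (subst ln_div) auto
    moreover have "ln ?t \<le> ?t - 1" by (rule ln_le_minus_one) (use R k w' in auto)
    ultimately show "ln \<omega> + 1 / (k * \<omega>) * R \<le> ln \<omega>' + 1 / (k * \<omega>') * R"
      using R k unfolding eq by simp
  qed
qed

section \<open>Maximum likelihood estimates of a DAG model\<close>

declare vec_of_list_map [simp del]

abbreviation pa_vec :: "(nat \<times> nat) set \<Rightarrow> nat \<Rightarrow> (nat \<Rightarrow> 'a) \<Rightarrow> 'a vec" where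
  "pa_vec G i g \<equiv> vec_of_list (map g (pa_list G i))"

abbreviation weights :: "(nat \<times> nat) set \<Rightarrow> 'a mat \<Rightarrow> nat \<Rightarrow> 'a vec" where
  "weights G \<Lambda> i \<equiv> pa_vec G i (\<lambda>j. \<Lambda> $$ (i, j))"

text \<open>The weight part of \<open>dag_params\<close>, separated from the variances because the
  limit always has admissible weights while its variances may be zero.\<close>

definition edge_weights :: "nat \<Rightarrow> (nat \<times> nat) set \<Rightarrow> 'a :: zero mat set" where
  "edge_weights m G = {\<Lambda> \<in> carrier_mat m m. \<forall>i<m. \<forall>j<m. (j, i) \<notin> G \<longrightarrow> \<Lambda> $$ (i, j) = 0}"

lemma dag_params_iff:
  "(\<Lambda>, \<omega>) \<in> dag_params m G \<longleftrightarrow> \<Lambda> \<in> edge_weights m G \<and> \<omega> \<in> carrier_vec m \<and> (\<forall>i<m. 0 < \<omega> $ i)"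
  by (auto simp: dag_params_def edge_weights_def)

locale dag_model =
  fixes n m :: nat and G :: "(nat \<times> nat) set"
  assumes le: "m \<le> n" and dag: "dag m G"
begin

lemma pa_less: "j \<in> pa G i \<Longrightarrow> j < m"
  using dag by (auto simp: dag_def pa_def)

lemma not_in_pa: "i \<notin> pa G i"
  using dag by (auto simp: dag_def pa_def acyclic_def)

lemma finite_pa [simp]: "finite (pa G i)"
  by (rule finite_subset[of _ "{..<m}"]) (auto dest: pa_less)

lemma pa_list [simp]: "set (pa_list G i) = pa G i" "distinct (pa_list G i)" "length (pa_list G i) = card (pa G i)"
  by (auto simp: pa_list_def)

lemma nth_pa_list [simp]: "k < card (pa G i) \<Longrightarrow> pa_list G i ! k \<in> pa G i"
  using nth_mem[of k "pa_list G i"] by simp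

lemma nth_pa_list_less [simp]: "k < card (pa G i) \<Longrightarrow> pa_list G i ! k < m"
  using pa_less nth_pa_list by blast

lemma pa_vec_carrier [simp]: "pa_vec G i g \<in> carrier_vec (card (pa G i))"
  by (auto intro!: carrier_vecI)

lemma pa_vec_index [simp]: "k < card (pa G i) \<Longrightarrow> pa_vec G i g $ k = g (pa_list G i ! k)"
  by (simp add: vec_of_list_index)

lemma pa_index: "j \<in> pa G i \<Longrightarrow> \<exists>k<card (pa G i). pa_list G i ! k = j"
  using pa_list[of i] by (metis in_set_conv_nth)

lemma pa_vec_eq_iff: "pa_vec G i g = pa_vec G i h \<longleftrightarrow> (\<forall>j\<in>pa G i. g j = h j)"
proof
  assume eq: "pa_vec G i g = pa_vec G i h"
  show "\<forall>j\<in>pa G i. g j = h j"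
  proof
    fix j assume "j \<in> pa G i"
    then obtain k where "k < card (pa G i)" "pa_list G i ! k = j" using pa_index by blast
    thus "g j = h j" using arg_cong[OF eq, of "\<lambda>x. x $ k"] by simp
  qed
qed (auto intro!: eq_vecI)

lemma pa_vec_surj:
  assumes "x \<in> carrier_vec (card (pa G i))"
  shows "\<exists>g. x = pa_vec G i g"
proof -
  have inj: "inj_on ((!) (pa_list G i)) {..<card (pa G i)}"
    using inj_on_nth[of "pa_list G i" "{..<card (pa G i)}"] by simp
  have "x = pa_vec G i (\<lambda>j. x $ (inv_into {..<card (pa G i)} ((!) (pa_list G i)) j))"
    using assms inv_into_f_f[OF inj] by (intro eq_vecI) auto
  thus ?thesis by blast
qed

text \<open>Weights at different vertices can be chosen independently. Together with
  \<open>edge_weights_eqI\<close> this presents the weight matrices as a product over the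
  vertices.\<close>

lemma edge_weights_exist:
  assumes "\<And>i. i < m \<Longrightarrow> x i \<in> carrier_vec (card (pa G i))"
  shows "\<exists>\<Lambda>\<in>edge_weights m G. \<forall>i<m. weights G \<Lambda> i = (x i :: 'a :: zero vec)"
proof -
  have "\<forall>i. \<exists>g. i < m \<longrightarrow> x i = pa_vec G i g" using pa_vec_surj assms by blast
  then obtain g where g: "i < m \<Longrightarrow> x i = pa_vec G i (g i)" for i by metis
  let ?L = "mat m m (\<lambda>(i, j). if j \<in> pa G i then g i j else 0)"
  have "weights G ?L i = x i" if "i < m" for i
    unfolding g[OF that] pa_vec_eq_iff using that pa_less by auto
  thus ?thesis by (intro bexI[of _ ?L]) (auto simp: edge_weights_def pa_def)
qed

lemma edge_weights_eqI:
  assumes "\<Lambda> \<in> edge_weights m G" "\<Lambda>' \<in> edge_weights m G"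
    and "\<And>i. i < m \<Longrightarrow> weights G \<Lambda> i = weights G \<Lambda>' i"
  shows "\<Lambda> = \<Lambda>'"
proof (rule eq_matI)
  fix i j assume "i < dim_row \<Lambda>'" "j < dim_col \<Lambda>'"
  hence ij: "i < m" "j < m" using assms(2) by (auto simp: edge_weights_def)
  show "\<Lambda> $$ (i, j) = \<Lambda>' $$ (i, j)"
    using ij assms pa_vec_eq_iff[where i = i and g = "\<lambda>j. \<Lambda> $$ (i, j)" and h = "\<lambda>j. \<Lambda>' $$ (i, j)"]
    by (cases "j \<in> pa G i") (auto simp: edge_weights_def pa_def)
qed (use assms in \<open>auto simp: edge_weights_def\<close>)

section \<open>Matrices of parent columns and residuals\<close>

lemma pa_mat_carrier [simp]: "pa_mat n G Y i \<in> carrier_mat n (card (pa G i))"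
  "dim_row (pa_mat n G Y i) = n" "dim_col (pa_mat n G Y i) = card (pa G i)"
  unfolding pa_mat_def by (auto simp: mat_of_cols_def)

lemma col_pa_mat:
  assumes "Y \<in> carrier_mat n m" "k < card (pa G i)"
  shows "col (pa_mat n G Y i) k = col Y (pa_list G i ! k)"
  using assms unfolding pa_mat_def by (subst col_mat_of_cols) auto

lemma set_cols_pa_mat:
  assumes "Y \<in> carrier_mat n m"
  shows "set (cols (pa_mat n G Y i)) = col Y ` pa G i"
  using assms unfolding pa_mat_def by (subst cols_mat_of_cols) auto

lemma pa_mat_mult:
  fixes Y :: "'a :: real_or_complex mat"
  assumes Y: "Y \<in> carrier_mat n m"
  shows "pa_mat n G Y i *\<^sub>v pa_vec G i g = Matrix.vec n (\<lambda>k. \<Sum>j\<in>pa G i. g j * Y $$ (k, j))"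
proof (rule eq_vecI)
  fix k assume "k < dim_vec (Matrix.vec n (\<lambda>k. \<Sum>j\<in>pa G i. g j * Y $$ (k, j)))"
  hence k: "k < n" by simp
  have bij: "bij_betw ((!) (pa_list G i)) {..<card (pa G i)} (pa G i)"
    by (rule bij_betw_nth) simp_all
  have "(pa_mat n G Y i *\<^sub>v pa_vec G i g) $ k =
    (\<Sum>l<card (pa G i). g (pa_list G i ! l) * Y $$ (k, pa_list G i ! l))"
    using k Y pa_less
    by (auto simp: scalar_prod_def lessThan_atLeast0 pa_mat_def mat_of_cols_def mult.commute intro!: sum.cong)
  also have "\<dots> = (\<Sum>j\<in>pa G i. g j * Y $$ (k, j))"
    by (rule sum.reindex_bij_betw[OF bij, of "\<lambda>j. g j * Y $$ (k, j)"])
  finally show "(pa_mat n G Y i *\<^sub>v pa_vec G i g) $ k = Matrix.vec n (\<lambda>k. \<Sum>j\<in>pa G i. g j * Y $$ (k, j)) $ k"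
    using k by simp
qed simp

text \<open>Serves two purposes: with h = 0 it extends a combination of parent columns by zeros, and
  with h the indicator of i it expresses a residual.\<close>

lemma mult_mat_vec_pa:
  fixes Y :: "'a :: real_or_complex mat"
  assumes Y: "Y \<in> carrier_mat n m" and k: "k < n"
  shows "(Y *\<^sub>v Matrix.vec m (\<lambda>j. if j \<in> pa G i then g j else h j)) $ k =
    (\<Sum>j\<in>pa G i. g j * Y $$ (k, j)) + (\<Sum>j\<in>{..<m} - pa G i. h j * Y $$ (k, j))"
proof -
  have sub: "pa G i \<subseteq> {..<m}" using pa_less by blast
  have "(Y *\<^sub>v Matrix.vec m (\<lambda>j. if j \<in> pa G i then g j else h j)) $ k =
    (\<Sum>j<m. (if j \<in> pa G i then g j else h j) * Y $$ (k, j))"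
    using Y k by (auto simp: scalar_prod_def lessThan_atLeast0 mult.commute intro!: sum.cong)
  also have "\<dots> = (\<Sum>j\<in>pa G i. g j * Y $$ (k, j)) + (\<Sum>j\<in>{..<m} - pa G i. h j * Y $$ (k, j))"
    by (subst sum.subset_diff[OF sub]) (auto simp: add.commute intro!: arg_cong2[of _ _ _ _ "(+)"] sum.cong)
  finally show ?thesis .
qed

lemma pa_mat_mult_eq_mat_mult:
  fixes Y :: "'a :: real_or_complex mat"
  assumes Y: "Y \<in> carrier_mat n m"
  shows "pa_mat n G Y i *\<^sub>v pa_vec G i g = Y *\<^sub>v Matrix.vec m (\<lambda>j. if j \<in> pa G i then g j else 0)"
  unfolding pa_mat_mult[OF Y]
  by (rule eq_vecI) (use Y mult_mat_vec_pa[OF Y, of _ i g "\<lambda>_. 0"] in \<open>auto simp del: index_mult_mat_vec\<close>)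

lemma residual_eq:
  fixes Y :: "'a :: real_or_complex mat"
  assumes Y: "Y \<in> carrier_mat n m" and i: "i < m"
  shows "residual n G Y \<Lambda> i = col Y i - pa_mat n G Y i *\<^sub>v weights G \<Lambda> i"
  unfolding residual_def pa_mat_mult[OF Y] using Y i by (intro eq_vecI) auto

text \<open>The vector on the right has entry 1 at i, as i is not its own parent. It is therefore
  non-zero, and an injective \<open>Y\<close> has no zero residual.\<close>

lemma residual_eq_mult:
  fixes Y :: "'a :: real_or_complex mat"
  assumes Y: "Y \<in> carrier_mat n m" and i: "i < m"
  shows "residual n G Y \<Lambda> i =
    Y *\<^sub>v Matrix.vec m (\<lambda>j. if j \<in> pa G i then - \<Lambda> $$ (i, j) else if j = i then 1 else 0)"
proof (rule eq_vecI)
  fix k assume "k < dim_vec (Y *\<^sub>v Matrix.vec m (\<lambda>j. if j \<in> pa G i then - \<Lambda> $$ (i, j) else if j = i then 1 else 0))"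
  hence k: "k < n" using Y by simp
  have "(\<Sum>j\<in>{..<m} - pa G i. (if j = i then 1 else 0) * Y $$ (k, j)) = Y $$ (k, i)"
    using i not_in_pa by (subst sum.remove[of _ i]) auto
  thus "residual n G Y \<Lambda> i $ k = (Y *\<^sub>v Matrix.vec m (\<lambda>j. if j \<in> pa G i then - \<Lambda> $$ (i, j) else if j = i then 1 else 0)) $ k"
    unfolding mult_mat_vec_pa[OF Y k] using k by (simp add: residual_def sum_negf)
qed (use Y in \<open>auto simp: residual_def\<close>)

section \<open>Separation of the likelihood over the vertices\<close>

definition loss :: "'a :: real_or_complex mat \<Rightarrow> nat \<Rightarrow> 'a vec \<Rightarrow> real" where
  "loss Y i x = norm_sq (col Y i - pa_mat n G Y i *\<^sub>v x)"

lemma loss_nonneg: "0 \<le> loss Y i x"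
  unfolding loss_def by (rule norm_sq_nonneg)

lemma least_squares_iff_loss:
  assumes "Y \<in> carrier_mat n m" "i < m"
  shows "least_squares (pa_mat n G Y i) (col Y i) x \<longleftrightarrow>
    x \<in> carrier_vec (card (pa G i)) \<and> (\<forall>y\<in>carrier_vec (card (pa G i)). loss Y i x \<le> loss Y i y)"
  unfolding loss_def using assms by (intro least_squares_iff_min[of _ n]) auto

lemma neg_log_lik_eq:
  fixes Y :: "'a :: real_or_complex mat"
  assumes Y: "Y \<in> carrier_mat n m"
  shows "neg_log_lik n m G Y (\<Lambda>, \<omega>) = (\<Sum>i<m. ln (\<omega> $ i) + 1 / (real n * \<omega> $ i) * loss Y i (weights G \<Lambda> i))"
  unfolding neg_log_lik_def loss_def by (simp add: residual_eq[OF Y])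

text \<open>For a fixed variance the term increases with the loss, so x has to minimise the loss
  whatever the variance is. The variance is then optimised for that one loss.\<close>

lemma vertex_minimal_iff:
  fixes Y :: "'a :: real_or_complex mat"
  assumes Y: "Y \<in> carrier_mat n m" and i: "i < m"
    and x: "x \<in> carrier_vec (card (pa G i))" and w: "0 < w"
  shows "(\<forall>y\<in>carrier_vec (card (pa G i)). \<forall>u>0.
      ln w + 1 / (real n * w) * loss Y i x \<le> ln u + 1 / (real n * u) * loss Y i y) \<longleftrightarrow>
    least_squares (pa_mat n G Y i) (col Y i) x \<and> w = loss Y i x / n" (is "?L \<longleftrightarrow> ?R")
proof
  have n: "0 < real n" using i le by simp
  {
    assume L: ?L
    have "loss Y i x \<le> loss Y i y" if "y \<in> carrier_vec (card (pa G i))" for y :: "'a vec"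
    proof -
      have "1 / (real n * w) * loss Y i x \<le> 1 / (real n * w) * loss Y i y"
        using L that w by fastforce
      thus ?thesis by (rule mult_left_le_imp_le) (use n w in simp)
    qed
    thus ?R
      using L x log_plus_ratio_min_iff[OF n w loss_nonneg[of Y i x]] least_squares_iff_loss[OF Y i] by blast
  next
    assume R: ?R
    show ?L
    proof (intro ballI allI impI)
      fix y :: "'a vec" and u assume y: "y \<in> carrier_vec (card (pa G i))" and u: "(0::real) < u"
      have "ln w + 1 / (real n * w) * loss Y i x \<le> ln u + 1 / (real n * u) * loss Y i x"
        using R u log_plus_ratio_min_iff[OF n w loss_nonneg[of Y i x]] by blast
      also have "\<dots> \<le> ln u + 1 / (real n * u) * loss Y i y"
        using R y u n least_squares_iff_loss[OF Y i] by (intro add_left_mono mult_left_mono) auto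
      finally show "ln w + 1 / (real n * w) * loss Y i x \<le> ln u + 1 / (real n * u) * loss Y i y" .
    qed
  }
qed

text \<open>The parameters form a product over the vertices and the likelihood is a sum over them,
  so minimising the sum means minimising every term.\<close>

lemma is_mle_iff:
  fixes Y :: "'a :: real_or_complex mat"
  assumes Y: "Y \<in> carrier_mat n m"
  shows "is_mle n m G Y (\<Lambda>, \<omega>) \<longleftrightarrow> (\<Lambda>, \<omega>) \<in> dag_params m G \<and>
    (\<forall>i<m. least_squares (pa_mat n G Y i) (col Y i) (weights G \<Lambda> i) \<and>
      \<omega> $ i = loss Y i (weights G \<Lambda> i) / n)" (is "_ \<longleftrightarrow> ?P \<and> ?Q")
proof -
  let ?l = "\<lambda>i x w. ln w + 1 / (real n * w) * loss Y i x"
  have "\<not> (\<exists>q. q \<in> dag_params m G \<and> neg_log_lik n m G Y q < neg_log_lik n m G Y (\<Lambda>, \<omega>)) \<longleftrightarrow>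
      (\<forall>i<m. \<forall>y\<in>carrier_vec (card (pa G i)). \<forall>u>0. ?l i (weights G \<Lambda> i) (\<omega> $ i) \<le> ?l i y u)"
    (is "?A \<longleftrightarrow> ?B") if P: ?P
  proof (intro iffI allI ballI impI)
    assume ?A
    fix i and y :: "'a vec" and u :: real assume i: "i < m" and y: "y \<in> carrier_vec (card (pa G i))" and u: "0 < u"
    \<comment> \<open>The competitor differs from the given parameter at vertex i only, so all other
      terms cancel in the comparison.\<close>
    obtain \<Lambda>' where \<Lambda>': "\<Lambda>' \<in> edge_weights m G" "\<And>k. k < m \<Longrightarrow> weights G \<Lambda>' k = (if k = i then y else weights G \<Lambda> k)"
      using edge_weights_exist[of "\<lambda>k. if k = i then y else weights G \<Lambda> k"] y by force
    let ?w = "Matrix.vec m (\<lambda>k. if k = i then u else \<omega> $ k)"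
    have "(\<Lambda>', ?w) \<in> dag_params m G" using P \<Lambda>' u by (auto simp: dag_params_iff)
    hence "neg_log_lik n m G Y (\<Lambda>, \<omega>) \<le> neg_log_lik n m G Y (\<Lambda>', ?w)" using \<open>?A\<close> by (auto simp: not_less)
    thus "?l i (weights G \<Lambda> i) (\<omega> $ i) \<le> ?l i y u"
      using i \<Lambda>'(2) unfolding neg_log_lik_eq[OF Y] by (simp add: sum.remove[of "{..<m}" i] del: times_divide_eq_left mult_1)
  next
    assume B: ?B
    have "neg_log_lik n m G Y (\<Lambda>, \<omega>) \<le> neg_log_lik n m G Y q" if "q \<in> dag_params m G" for q
    proof (cases q)
      case (Pair \<Lambda>' \<omega>')
      hence "\<forall>i<m. 0 < \<omega>' $ i" using that by (simp add: dag_params_iff)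
      thus ?thesis unfolding Pair neg_log_lik_eq[OF Y] using B by (intro sum_mono) simp
    qed
    thus ?A by (auto simp: not_less)
  qed
  moreover have "?B \<longleftrightarrow> ?Q" if ?P
    using that vertex_minimal_iff[OF Y] by (auto simp: dag_params_iff)
  ultimately show ?thesis unfolding is_mle_def is_arg_min_def by blast
qed

text \<open>Injectivity serves twice: it keeps the residuals, and so the variances, from vanishing,
  and it makes the parent columns independent, so that the least squares solutions are
  unique.\<close>

lemma mle_unique:
  fixes Y :: "'a :: real_or_complex mat"
  assumes Y: "Y \<in> carrier_mat n m"
    and inj: "\<And>x. x \<in> carrier_vec m \<Longrightarrow> Y *\<^sub>v x = 0\<^sub>v n \<Longrightarrow> x = 0\<^sub>v m"
  shows "\<exists>!q. is_mle n m G Y q"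
proof (rule ex_ex1I)
  have "\<exists>x. least_squares (pa_mat n G Y i) (col Y i) x" if "i < m" for i
    using that Y by (intro least_squares_exists[of _ n]) auto
  then obtain x where x: "\<And>i. i < m \<Longrightarrow> least_squares (pa_mat n G Y i) (col Y i) (x i)" by metis
  obtain \<Lambda> where \<Lambda>: "\<Lambda> \<in> edge_weights m G" "\<And>i. i < m \<Longrightarrow> weights G \<Lambda> i = x i"
    using edge_weights_exist[of x] x by (auto simp: least_squares_def)
  have pos: "0 < loss Y i (weights G \<Lambda> i)" if i: "i < m" for i
  proof (rule ccontr)
    assume "\<not> 0 < loss Y i (weights G \<Lambda> i)"
    hence "norm_sq (residual n G Y \<Lambda> i) = 0"
      using loss_nonneg[of Y i "weights G \<Lambda> i"] by (simp add: loss_def residual_eq[OF Y i])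
    hence "residual n G Y \<Lambda> i = 0\<^sub>v n"
      by (subst (asm) norm_sq_eq_0_iff[of _ n]) (auto simp: residual_def)
    hence "Matrix.vec m (\<lambda>j. if j \<in> pa G i then - \<Lambda> $$ (i, j) else if j = i then 1 else 0) = 0\<^sub>v m"
      unfolding residual_eq_mult[OF Y i] by (intro inj) auto
    from arg_cong[OF this, of "\<lambda>u. u $ i"] show False using i not_in_pa by simp
  qed
  have "(\<Lambda>, Matrix.vec m (\<lambda>i. loss Y i (weights G \<Lambda> i) / n)) \<in> dag_params m G"
    using \<Lambda>(1) pos le by (auto simp: dag_params_iff intro!: divide_pos_pos)
  thus "\<exists>q. is_mle n m G Y q"
    using \<Lambda>(2) x
    by (intro exI[of _ "(\<Lambda>, Matrix.vec m (\<lambda>i. loss Y i (weights G \<Lambda> i) / n))"]) (auto simp: is_mle_iff[OF Y])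
next
  fix q q' assume q: "is_mle n m G Y q" "is_mle n m G Y q'"
  obtain \<Lambda> \<omega> \<Lambda>' \<omega>' where eq: "q = (\<Lambda>, \<omega>)" "q' = (\<Lambda>', \<omega>')" by (cases q, cases q')
  have w: "weights G \<Lambda> i = weights G \<Lambda>' i" if i: "i < m" for i
  proof (rule least_squares_unique[of "pa_mat n G Y i" n "card (pa G i)" "col Y i"])
    fix x :: "'a vec" assume x: "x \<in> carrier_vec (card (pa G i))" "pa_mat n G Y i *\<^sub>v x = 0\<^sub>v n"
    obtain g where g: "x = pa_vec G i g" using pa_vec_surj[OF x(1)] by blast
    have "Matrix.vec m (\<lambda>j. if j \<in> pa G i then g j else 0) = 0\<^sub>v m"
      using x(2) unfolding g pa_mat_mult_eq_mat_mult[OF Y] by (intro inj) auto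
    hence "\<forall>j<m. j \<in> pa G i \<longrightarrow> g j = 0" by (auto simp: vec_eq_iff split: if_splits)
    hence "pa_vec G i g = pa_vec G i (\<lambda>_. 0)" unfolding pa_vec_eq_iff using pa_less by blast
    thus "x = 0\<^sub>v (card (pa G i))" unfolding g by (auto intro!: eq_vecI)
  qed (use q i Y in \<open>auto simp: eq is_mle_iff[OF Y]\<close>)
  have "\<Lambda> = \<Lambda>'"
    using q w by (intro edge_weights_eqI) (auto simp: eq is_mle_iff[OF Y] dag_params_iff)
  moreover have "\<omega> = \<omega>'"
    using q w by (intro eq_vecI) (auto simp: eq is_mle_iff[OF Y] dag_params_iff)
  ultimately show "q = q'" by (simp add: eq)
qed

end

section \<open>Stabilisations\<close>

locale stabilisation = dag_model n m G for n m :: nat and G :: "(nat \<times> nat) set" +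
  fixes f f' :: "'a :: real_or_complex mat"
  assumes f [simp]: "f \<in> carrier_mat n m" and perturbation: "perturbation n m f f'"
begin

lemma f' [simp]: "f' \<in> carrier_mat n m"
  using perturbation by (simp add: perturbation_def)

lemma dims_f [simp]: "dim_row f = n" "dim_col f = m" "dim_row f' = n" "dim_col f' = m"
  using carrier_matD[OF f] carrier_matD[OF f'] by auto

lemma col_f_carrier [simp]: "col f i \<in> carrier_vec n" "col f' i \<in> carrier_vec n"
  by (auto intro!: carrier_vecI)

lemma images_orthogonal:
  assumes "x \<in> carrier_vec m" "y \<in> carrier_vec m"
  shows "(f' *\<^sub>v x) \<bullet>c (f *\<^sub>v y) = 0" "(f *\<^sub>v y) \<bullet>c (f' *\<^sub>v x) = 0"
proof -
  show 0: "(f' *\<^sub>v x) \<bullet>c (f *\<^sub>v y) = 0"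
    using perturbation assms by (auto simp: perturbation_def orth_compl_def mat_image_def)
  show "(f *\<^sub>v y) \<bullet>c (f' *\<^sub>v x) = 0"
    using cscalar_prod_swap[of "f' *\<^sub>v x" n "f *\<^sub>v y"] 0 assms mult_mat_vec_carrier[OF f] mult_mat_vec_carrier[OF f'] by simp
qed

text \<open>The kernel of f is the orthogonal complement of that of f', so a common element is
  orthogonal to itself.\<close>

lemma kernels_independent:
  assumes x: "x \<in> carrier_vec m" and 0: "f *\<^sub>v x = 0\<^sub>v n" "f' *\<^sub>v x = 0\<^sub>v n"
  shows "x = 0\<^sub>v m"
proof -
  have "x \<in> mat_kernel f'" using 0 x by (simp add: mat_kernel_def)
  moreover have "x \<in> orth_compl m (mat_kernel f')"
    using perturbation 0 x by (simp add: perturbation_def mat_kernel_def)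
  ultimately have "x \<bullet>c x = 0" by (simp add: orth_compl_def)
  hence "(of_real (norm_sq x) :: 'a) = 0" unfolding of_real_norm_sq .
  thus ?thesis using norm_sq_eq_0_iff[OF x] by simp
qed

lemma orthogonal_add_eq_0:
  assumes u: "u \<in> carrier_vec n" and v: "v \<in> carrier_vec n" and o: "u \<bullet>c v = 0"
    and 0: "u + v = (0\<^sub>v n :: 'a vec)"
  shows "u = 0\<^sub>v n" "v = 0\<^sub>v n"
proof -
  have "norm_sq u + norm_sq v = 0"
    using norm_sq_add_orthogonal[OF u v o] 0 norm_sq_eq_0_iff[of "0\<^sub>v n :: 'a vec" n] by simp
  thus "u = 0\<^sub>v n" "v = 0\<^sub>v n"
    using norm_sq_nonneg[of u] norm_sq_nonneg[of v] norm_sq_eq_0_iff[OF u] norm_sq_eq_0_iff[OF v] by auto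
qed

lemma smult_f' [simp]: "\<epsilon> \<cdot>\<^sub>m f' \<in> carrier_mat n m" "f + \<epsilon> \<cdot>\<^sub>m f' \<in> carrier_mat n m"
  by auto

text \<open>Orthogonality of the images splits the equation into f x = 0 and \<epsilon> f' x =
  0.\<close>

lemma stabilised_injective:
  assumes e: "\<epsilon> \<noteq> 0" and x: "x \<in> carrier_vec m" and 0: "(f + \<epsilon> \<cdot>\<^sub>m f') *\<^sub>v x = 0\<^sub>v n"
  shows "x = 0\<^sub>v m"
proof -
  have fx: "f *\<^sub>v x \<in> carrier_vec n" "f' *\<^sub>v x \<in> carrier_vec n" using x mult_mat_vec_carrier[OF f] mult_mat_vec_carrier[OF f'] by auto
  have "f *\<^sub>v x + \<epsilon> \<cdot>\<^sub>v (f' *\<^sub>v x) = 0\<^sub>v n"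
    using 0 x by (simp add: add_mult_distrib_mat_vec[of _ n m] smult_mat_mult_vec[of _ n m])
  moreover have "(f *\<^sub>v x) \<bullet>c (\<epsilon> \<cdot>\<^sub>v (f' *\<^sub>v x)) = 0"
    using images_orthogonal[OF x x] fx by (simp add: conjugate_smult_vec)
  ultimately have "f *\<^sub>v x = 0\<^sub>v n" "\<epsilon> \<cdot>\<^sub>v (f' *\<^sub>v x) = 0\<^sub>v n"
    using orthogonal_add_eq_0[of "f *\<^sub>v x" "\<epsilon> \<cdot>\<^sub>v (f' *\<^sub>v x)"] fx by auto
  moreover from this(2) have "f' *\<^sub>v x = 0\<^sub>v n" using e by (auto simp: vec_eq_iff)
  ultimately show ?thesis using kernels_independent x by blast
qed

lemma stabilised_mle_unique: "\<epsilon> \<noteq> 0 \<Longrightarrow> \<exists>!q. is_mle n m G (f + \<epsilon> \<cdot>\<^sub>m f') q"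
  using stabilised_injective by (intro mle_unique) auto

lemma is_mle_mle:
  "\<epsilon> \<noteq> 0 \<Longrightarrow> is_mle n m G (f + \<epsilon> \<cdot>\<^sub>m f') (mle n m G (f + \<epsilon> \<cdot>\<^sub>m f'))"
  unfolding mle_def by (rule theI') (rule stabilised_mle_unique)

lemma mle_stabilised:
  assumes "\<epsilon> \<noteq> 0"
  defines "\<Lambda> \<equiv> fst (mle n m G (f + \<epsilon> \<cdot>\<^sub>m f'))" and "\<omega> \<equiv> snd (mle n m G (f + \<epsilon> \<cdot>\<^sub>m f'))"
  shows "\<Lambda> \<in> edge_weights m G"
    and "i < m \<Longrightarrow> least_squares (pa_mat n G (f + \<epsilon> \<cdot>\<^sub>m f') i) (col (f + \<epsilon> \<cdot>\<^sub>m f') i) (weights G \<Lambda> i)"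
    and "i < m \<Longrightarrow> \<omega> $ i = loss (f + \<epsilon> \<cdot>\<^sub>m f') i (weights G \<Lambda> i) / n"
proof -
  have "is_mle n m G (f + \<epsilon> \<cdot>\<^sub>m f') (\<Lambda>, \<omega>)"
    using is_mle_mle[OF assms(1)] by (simp add: \<Lambda>_def \<omega>_def)
  note this[unfolded is_mle_iff[OF smult_f'(2)]]
  thus "\<Lambda> \<in> edge_weights m G"
    and "i < m \<Longrightarrow> least_squares (pa_mat n G (f + \<epsilon> \<cdot>\<^sub>m f') i) (col (f + \<epsilon> \<cdot>\<^sub>m f') i) (weights G \<Lambda> i)"
    and "i < m \<Longrightarrow> \<omega> $ i = loss (f + \<epsilon> \<cdot>\<^sub>m f') i (weights G \<Lambda> i) / n" by (auto simp: dag_params_iff)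
qed

section \<open>Normal equations of a stabilised sample\<close>

abbreviation "A \<equiv> pa_mat n G f"
abbreviation "E \<equiv> pa_mat n G f'"

text \<open>Padding by zeros outside the parents carries the orthogonality of the images of f and f'
  over to the parent matrices.\<close>

lemma pa_mat_mult_in_image:
  assumes Y: "Y \<in> carrier_mat n m" and x: "x \<in> carrier_vec (card (pa G i))"
  shows "\<exists>u\<in>carrier_vec m. pa_mat n G Y i *\<^sub>v x = (Y :: 'a mat) *\<^sub>v u"
proof -
  obtain g where g: "x = pa_vec G i g" using pa_vec_surj[OF x] by blast
  show ?thesis unfolding g pa_mat_mult_eq_mat_mult[OF Y]
    by (rule bexI, rule refl, simp)
qed

lemma col_in_image: "Y \<in> carrier_mat n m \<Longrightarrow> i < m \<Longrightarrow> col Y i = (Y :: 'a mat) *\<^sub>v unit_vec m i"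
  by (intro eq_vecI) auto

lemma residual_in_image:
  assumes Y: "Y \<in> carrier_mat n m" and i: "i < m" and x: "x \<in> carrier_vec (card (pa G i))"
  shows "\<exists>u\<in>carrier_vec m. col Y i - pa_mat n G Y i *\<^sub>v x = (Y :: 'a mat) *\<^sub>v u"
proof -
  obtain u where "u \<in> carrier_vec m" "pa_mat n G Y i *\<^sub>v x = Y *\<^sub>v u"
    using pa_mat_mult_in_image[OF Y x] by blast
  thus ?thesis using Y i mult_mat_vec_diff[OF Y unit_vec_carrier, of u i]
    by (intro bexI[of _ "unit_vec m i - u"]) (auto simp: col_in_image[OF Y i])
qed

text \<open>These are the mixed terms, linear in \<epsilon> or in its conjugate, of the normal
  equations at f + \<epsilon> f'.\<close>

lemma adjoint_orthogonal:
  assumes "x \<in> carrier_vec m"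
  shows "mat_adjoint (A i) *\<^sub>v (f' *\<^sub>v x) = 0\<^sub>v (card (pa G i))"
    "mat_adjoint (E i) *\<^sub>v (f *\<^sub>v x) = 0\<^sub>v (card (pa G i))"
proof -
  have c: "f *\<^sub>v x \<in> carrier_vec n" "f' *\<^sub>v x \<in> carrier_vec n"
    using assms mult_mat_vec_carrier[OF f] mult_mat_vec_carrier[OF f'] by auto
  show "mat_adjoint (A i) *\<^sub>v (f' *\<^sub>v x) = 0\<^sub>v (card (pa G i))"
    unfolding mat_adjoint_eq_0_iff[OF pa_mat_carrier(1) c(2)]
    using pa_mat_mult_in_image[OF f] images_orthogonal(2)[OF assms] by fastforce
  show "mat_adjoint (E i) *\<^sub>v (f *\<^sub>v x) = 0\<^sub>v (card (pa G i))"
    unfolding mat_adjoint_eq_0_iff[OF pa_mat_carrier(1) c(1)]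
    using pa_mat_mult_in_image[OF f'] images_orthogonal(1)[OF _ assms] by fastforce
qed

lemma ridge:
  assumes "i < m"
  shows "ridge_regression n n (card (pa G i)) (A i) (E i) (col f i) (col f' i)"
proof
  fix x assume x: "x \<in> carrier_vec (card (pa G i))" "A i *\<^sub>v x = 0\<^sub>v n" "E i *\<^sub>v x = 0\<^sub>v n"
  obtain g where g: "x = pa_vec G i g" using pa_vec_surj[OF x(1)] by blast
  have "Matrix.vec m (\<lambda>j. if j \<in> pa G i then g j else 0) = 0\<^sub>v m"
    using x(2,3) unfolding g pa_mat_mult_eq_mat_mult[OF f] pa_mat_mult_eq_mat_mult[OF f']
    by (intro kernels_independent) auto
  hence "\<forall>j<m. j \<in> pa G i \<longrightarrow> g j = 0" by (auto simp: vec_eq_iff split: if_splits)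
  hence "pa_vec G i g = pa_vec G i (\<lambda>_. 0)" unfolding pa_vec_eq_iff using pa_less by blast
  thus "x = 0\<^sub>v (card (pa G i))" unfolding g by (auto intro!: eq_vecI)
qed auto

lemma pa_mat_stabilised: "pa_mat n G (f + \<epsilon> \<cdot>\<^sub>m f') i = A i + \<epsilon> \<cdot>\<^sub>m E i"
  by (intro eq_matI) (auto simp: pa_mat_def mat_of_cols_def)

lemma col_stabilised: "i < m \<Longrightarrow> col (f + \<epsilon> \<cdot>\<^sub>m f') i = col f i + \<epsilon> \<cdot>\<^sub>v col f' i"
  by (intro eq_vecI) auto

lemma stabilised_residual:
  assumes i: "i < m" and x: "x \<in> carrier_vec (card (pa G i))"
  shows "col (f + \<epsilon> \<cdot>\<^sub>m f') i - pa_mat n G (f + \<epsilon> \<cdot>\<^sub>m f') i *\<^sub>v x =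
    (col f i - A i *\<^sub>v x) + \<epsilon> \<cdot>\<^sub>v (col f' i - E i *\<^sub>v x)"
proof -
  have "(A i + \<epsilon> \<cdot>\<^sub>m E i) *\<^sub>v x = A i *\<^sub>v x + \<epsilon> \<cdot>\<^sub>v (E i *\<^sub>v x)"
    using x by (simp add: add_mult_distrib_mat_vec[of _ n "card (pa G i)"] smult_mat_mult_vec[of _ n "card (pa G i)"])
  thus ?thesis
    unfolding pa_mat_stabilised col_stabilised[OF i]
    by (intro eq_vecI) (auto simp: algebra_simps simp del: index_mult_mat_vec)
qed

text \<open>Once the mixed terms are gone, \<epsilon> enters only through conjugate \<epsilon> *
  \<epsilon> = |\<epsilon>|^2, which is real also for complex \<epsilon>.\<close>

lemma least_squares_stabilised_iff:
  assumes i: "i < m"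
  shows "least_squares (pa_mat n G (f + \<epsilon> \<cdot>\<^sub>m f') i) (col (f + \<epsilon> \<cdot>\<^sub>m f') i) x \<longleftrightarrow>
    x \<in> carrier_vec (card (pa G i)) \<and>
    (gram (A i) + of_real ((norm \<epsilon>)\<^sup>2) \<cdot>\<^sub>m gram (E i)) *\<^sub>v x =
    mat_adjoint (A i) *\<^sub>v col f i + of_real ((norm \<epsilon>)\<^sup>2) \<cdot>\<^sub>v (mat_adjoint (E i) *\<^sub>v col f' i)"
  (is "?L \<longleftrightarrow> _ \<and> ?R")
proof (cases "x \<in> carrier_vec (card (pa G i))")
  case x: True
  let ?p = "card (pa G i)"
  have gA: "gram (A i) \<in> carrier_mat ?p ?p" and gE: "gram (E i) \<in> carrier_mat ?p ?p"
    using gram_carrier pa_mat_carrier(1) by blast+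
  \<comment> \<open>The residuals are rewritten as values of f and f', the form in which
    \<open>adjoint_orthogonal\<close> applies.\<close>
  obtain u v where u: "u \<in> carrier_vec m" "col f i - A i *\<^sub>v x = f *\<^sub>v u"
    and v: "v \<in> carrier_vec m" "col f' i - E i *\<^sub>v x = f' *\<^sub>v v"
    using residual_in_image[OF f i x] residual_in_image[OF f' i x] by blast
  have mA: "mat_adjoint (A i) \<in> carrier_mat ?p n" and mE: "mat_adjoint (E i) \<in> carrier_mat ?p n"
    by (rule mat_adjoint_carrier, rule pa_mat_carrier(1))+
  have fu: "f *\<^sub>v u \<in> carrier_vec n" and fv: "f' *\<^sub>v v \<in> carrier_vec n"
    using u v mult_mat_vec_carrier[OF f] mult_mat_vec_carrier[OF f'] by auto
  have c: "mat_adjoint (A i) *\<^sub>v col f i \<in> carrier_vec ?p" "mat_adjoint (E i) *\<^sub>v col f' i \<in> carrier_vec ?p"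
    "gram (A i) *\<^sub>v x \<in> carrier_vec ?p" "gram (E i) *\<^sub>v x \<in> carrier_vec ?p"
    using mult_mat_vec_carrier[OF mA, of "col f i"] mult_mat_vec_carrier[OF mE, of "col f' i"]
      mult_mat_vec_carrier[OF gA x] mult_mat_vec_carrier[OF gE x] by auto
  have A_res: "mat_adjoint (A i) *\<^sub>v (f *\<^sub>v u) = mat_adjoint (A i) *\<^sub>v col f i - gram (A i) *\<^sub>v x"
    unfolding u(2)[symmetric] using mult_mat_vec_diff[OF mA, of "col f i" "A i *\<^sub>v x"] x
    by (simp add: gram_mult_vec[OF pa_mat_carrier(1) x] mult_mat_vec_carrier[OF pa_mat_carrier(1) x])
  have E_res: "mat_adjoint (E i) *\<^sub>v (f' *\<^sub>v v) = mat_adjoint (E i) *\<^sub>v col f' i - gram (E i) *\<^sub>v x"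
    unfolding v(2)[symmetric] using mult_mat_vec_diff[OF mE, of "col f' i" "E i *\<^sub>v x"] x
    by (simp add: gram_mult_vec[OF pa_mat_carrier(1) x] mult_mat_vec_carrier[OF pa_mat_carrier(1) x])
  have "mat_adjoint (A i + \<epsilon> \<cdot>\<^sub>m E i) = mat_adjoint (A i) + conjugate \<epsilon> \<cdot>\<^sub>m mat_adjoint (E i)"
    by (subst mat_adjoint_add[of _ n ?p]) (auto simp: mat_adjoint_smult)
  moreover have "conjugate \<epsilon> \<cdot>\<^sub>v 0\<^sub>v ?p = 0\<^sub>v ?p" by (intro eq_vecI) auto
  ultimately have "mat_adjoint (A i + \<epsilon> \<cdot>\<^sub>m E i) *\<^sub>v (f *\<^sub>v u + \<epsilon> \<cdot>\<^sub>v (f' *\<^sub>v v)) =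
     mat_adjoint (A i) *\<^sub>v (f *\<^sub>v u) + conjugate \<epsilon> \<cdot>\<^sub>v (\<epsilon> \<cdot>\<^sub>v (mat_adjoint (E i) *\<^sub>v (f' *\<^sub>v v)))"
    using mA mE fu fv adjoint_orthogonal(1)[OF v(1), of i] adjoint_orthogonal(2)[OF u(1), of i]
      mult_mat_vec_carrier[OF mA fu] mult_mat_vec_carrier[OF mE fv]
    by (simp add: add_mult_distrib_mat_vec[of _ ?p n] smult_mat_mult_vec[of _ ?p n]
      mult_add_distrib_mat_vec[of _ ?p n] mult_mat_vec[of _ ?p n] smult_smult_assoc mult.commute)
  also have "\<dots> = (mat_adjoint (A i) *\<^sub>v col f i - gram (A i) *\<^sub>v x) +
     of_real ((norm \<epsilon>)\<^sup>2) \<cdot>\<^sub>v (mat_adjoint (E i) *\<^sub>v col f' i - gram (E i) *\<^sub>v x)"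
    unfolding A_res E_res smult_smult_assoc mult_conjugate_of_real[symmetric] by (simp only: mult.commute)
  also have "\<dots> = (mat_adjoint (A i) *\<^sub>v col f i + of_real ((norm \<epsilon>)\<^sup>2) \<cdot>\<^sub>v (mat_adjoint (E i) *\<^sub>v col f' i)) -
     (gram (A i) *\<^sub>v x + of_real ((norm \<epsilon>)\<^sup>2) \<cdot>\<^sub>v (gram (E i) *\<^sub>v x))" (is "_ = ?b - ?c")
  proof -
    have "(\<alpha> - \<gamma>) + k \<cdot>\<^sub>v (\<beta> - \<delta>) = (\<alpha> + k \<cdot>\<^sub>v \<beta>) - (\<gamma> + k \<cdot>\<^sub>v \<delta>)"
      if "\<alpha> \<in> carrier_vec ?p" "\<beta> \<in> carrier_vec ?p" "\<gamma> \<in> carrier_vec ?p" "\<delta> \<in> carrier_vec ?p"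
      for \<alpha> \<beta> \<gamma> \<delta> :: "'a vec" and k
      using that by (intro eq_vecI) (auto simp: algebra_simps)
    thus ?thesis using c by blast
  qed
  also have "\<dots> = 0\<^sub>v ?p \<longleftrightarrow> ?b = ?c"
    using c by (intro minus_eq_zero_vec_iff) auto
  also have "?c = (gram (A i) + of_real ((norm \<epsilon>)\<^sup>2) \<cdot>\<^sub>m gram (E i)) *\<^sub>v x"
    using x gA gE by (simp add: add_mult_distrib_mat_vec[of _ ?p ?p] smult_mat_mult_vec[of _ ?p ?p])
  finally show ?thesis
    using x unfolding least_squares_def stabilised_residual[OF i x] u(2) v(2)
    by (auto simp: pa_mat_stabilised)
qed (auto simp: least_squares_def)


section \<open>The limit as eps tends to zero\<close>

definition limit_weights :: "nat \<Rightarrow> 'a vec" where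
  "limit_weights i = ridge_regression.ridge_limit (card (pa G i)) (A i) (E i) (col f i) (col f' i)"

lemma limit_weights_carrier [simp]: "i < m \<Longrightarrow> limit_weights i \<in> carrier_vec (card (pa G i))"
  unfolding limit_weights_def by (rule ridge_regression.ridge_limit_carrier[OF ridge])

lemma limit_weights_least_squares:
  assumes "i < m"
  shows "least_squares (A i) (col f i) (limit_weights i)"
  using ridge_regression.gram_ridge_limit[OF ridge[OF assms]] limit_weights_carrier[OF assms]
  unfolding least_squares_iff_gram[OF pa_mat_carrier(1) col_f_carrier(1)] limit_weights_def by blast

lemma tendsto_mle_weights:
  assumes i: "i < m" and k: "k < card (pa G i)"
  shows "((\<lambda>\<epsilon>. weights G (fst (mle n m G (f + \<epsilon> \<cdot>\<^sub>m f'))) i $ k) \<longlongrightarrow> limit_weights i $ k) (at 0)"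
proof -
  have "least_squares (pa_mat n G (f + \<epsilon> \<cdot>\<^sub>m f') i) (col (f + \<epsilon> \<cdot>\<^sub>m f') i)
    (weights G (fst (mle n m G (f + \<epsilon> \<cdot>\<^sub>m f'))) i)" if "\<epsilon> \<noteq> 0" for \<epsilon>
    using mle_stabilised(2)[OF that i] .
  thus ?thesis
    unfolding least_squares_stabilised_iff[OF i] limit_weights_def
    by (intro ridge_regression.tendsto_ridge_limit[OF ridge[OF i] _ _ k]) blast+
qed

text \<open>By \<open>edge_weights_eqI\<close> only one matrix qualifies, so the choice is
  determined.\<close>

definition limit_matrix :: "'a mat" where
  "limit_matrix = (SOME \<Lambda>. \<Lambda> \<in> edge_weights m G \<and> (\<forall>i<m. weights G \<Lambda> i = limit_weights i))"

lemma limit_matrix: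
  "limit_matrix \<in> edge_weights m G" "i < m \<Longrightarrow> weights G limit_matrix i = limit_weights i"
proof -
  have "\<exists>\<Lambda>. \<Lambda> \<in> edge_weights m G \<and> (\<forall>i<m. weights G \<Lambda> i = limit_weights i)"
    using edge_weights_exist[of limit_weights] limit_weights_carrier by blast
  from someI_ex[OF this] show "limit_matrix \<in> edge_weights m G"
    "i < m \<Longrightarrow> weights G limit_matrix i = limit_weights i"
    unfolding limit_matrix_def by blast+
qed

text \<open>Possibly not a parameter: a variance is zero wherever the column of f lies in the span
  of its parent columns.\<close>

definition limit_mle :: "'a param" where
  "limit_mle = (limit_matrix, Matrix.vec m (\<lambda>i. loss f i (limit_weights i) / n))"

lemma tendsto_mle_entry:
  assumes i: "i < m" and j: "j < m"
  shows "((\<lambda>\<epsilon>. fst (mle n m G (f + \<epsilon> \<cdot>\<^sub>m f')) $$ (i, j)) \<longlongrightarrow> limit_matrix $$ (i, j)) (at 0)"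
proof (cases "j \<in> pa G i")
  case True
  then obtain k where k: "k < card (pa G i)" "pa_list G i ! k = j" using pa_index by blast
  have "limit_weights i $ k = limit_matrix $$ (i, j)"
    using k limit_matrix(2)[OF i] by (metis pa_vec_index)
  thus ?thesis using tendsto_mle_weights[OF i k(1)] k by simp
next
  case False
  hence "limit_matrix $$ (i, j) = 0"
    using i j limit_matrix(1) by (auto simp: edge_weights_def pa_def)
  moreover have "fst (mle n m G (f + \<epsilon> \<cdot>\<^sub>m f')) $$ (i, j) = 0" if "\<epsilon> \<noteq> 0" for \<epsilon>
    using False i j mle_stabilised(1)[OF that] by (simp add: dag_params_iff edge_weights_def pa_def)
  ultimately show ?thesis
    by (intro tendsto_eventually) (auto simp: eventually_at_filter)
qed

text \<open>The loss, written out as a sum, is continuous in the sample entries and the weights, and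
  both converge.\<close>

lemma tendsto_mle_variance:
  assumes i: "i < m"
  shows "((\<lambda>\<epsilon>. snd (mle n m G (f + \<epsilon> \<cdot>\<^sub>m f')) $ i) \<longlongrightarrow> loss f i (limit_weights i) / n) (at 0)"
proof -
  have loss: "loss Y i (weights G \<Lambda> i) =
      (\<Sum>k<n. (norm (Y $$ (k, i) - (\<Sum>j\<in>pa G i. \<Lambda> $$ (i, j) * Y $$ (k, j))))\<^sup>2)"
    if Y: "Y \<in> carrier_mat n m" for Y \<Lambda> :: "'a mat"
    unfolding loss_def residual_eq[OF Y i, symmetric] by (simp add: norm_sq_def residual_def)
  have entry: "((\<lambda>\<epsilon>. (f + \<epsilon> \<cdot>\<^sub>m f') $$ (k, j)) \<longlongrightarrow> f $$ (k, j)) (at 0)" if "k < n" "j < m" for k j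
  proof -
    have "((\<lambda>\<epsilon>. f $$ (k, j) + \<epsilon> * f' $$ (k, j)) \<longlongrightarrow> f $$ (k, j) + 0 * f' $$ (k, j)) (at 0)"
      by (intro tendsto_intros)
    thus ?thesis using that by simp
  qed
  have "((\<lambda>\<epsilon>. loss (f + \<epsilon> \<cdot>\<^sub>m f') i (weights G (fst (mle n m G (f + \<epsilon> \<cdot>\<^sub>m f'))) i) / n) \<longlongrightarrow>
      loss f i (weights G limit_matrix i) / n) (at 0)"
    unfolding loss[OF f] loss[OF smult_f'(2)] divide_inverse
    by (intro tendsto_mult tendsto_const tendsto_sum tendsto_power tendsto_norm tendsto_diff
      entry tendsto_mle_entry i) (auto dest: pa_less)
  moreover have "loss (f + \<epsilon> \<cdot>\<^sub>m f') i (weights G (fst (mle n m G (f + \<epsilon> \<cdot>\<^sub>m f'))) i) / n = snd (mle n m G (f + \<epsilon> \<cdot>\<^sub>m f')) $ i"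
    if "\<epsilon> \<noteq> 0" for \<epsilon>
    using mle_stabilised(3)[OF that i] by simp
  ultimately show ?thesis
    unfolding limit_matrix(2)[OF i]
    by (auto intro: Lim_transform_eventually simp: eventually_at_filter)
qed

lemma is_limit_mle_iff: "is_limit_mle n m G f f' L \<longleftrightarrow> L = limit_mle"
proof
  assume L: "is_limit_mle n m G f f' L"
  obtain \<Lambda> \<omega> where eq: "L = (\<Lambda>, \<omega>)" by (cases L)
  note L = L[unfolded eq is_limit_mle_def, simplified]
  have "\<Lambda> = limit_matrix"
  proof (rule eq_matI)
    fix i j assume "i < dim_row limit_matrix" "j < dim_col limit_matrix"
    hence ij: "i < m" "j < m" using limit_matrix(1) by (auto simp: edge_weights_def)
    show "\<Lambda> $$ (i, j) = limit_matrix $$ (i, j)"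
      using L ij by (intro tendsto_unique[OF _ _ tendsto_mle_entry[OF ij]]) auto
  qed (use L limit_matrix(1) in \<open>auto simp: edge_weights_def\<close>)
  moreover have "\<omega> = Matrix.vec m (\<lambda>i. loss f i (limit_weights i) / n)"
    using L by (intro eq_vecI) (auto intro!: tendsto_unique[OF _ _ tendsto_mle_variance, of _ "\<omega> $ i" for i])
  ultimately show "L = limit_mle" by (simp add: eq limit_mle_def)
next
  assume "L = limit_mle"
  thus "is_limit_mle n m G f f' L"
    using limit_matrix(1) tendsto_mle_entry tendsto_mle_variance
    by (auto simp: is_limit_mle_def limit_mle_def edge_weights_def)
qed

text \<open>Only positivity of the variances is at stake. The limit weights and those of the given
  MLE both solve the least squares problem of f, hence share the fitted vector and its positive
  loss.\<close>

lemma is_mle_limit_mle: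
  assumes "is_mle n m G f q"
  shows "is_mle n m G f limit_mle"
proof -
  obtain \<Lambda> \<omega> where q: "q = (\<Lambda>, \<omega>)" by (cases q)
  note mle = assms[unfolded q is_mle_iff[OF f]]
  have "0 < loss f i (limit_weights i) / n" if i: "i < m" for i
  proof -
    have "loss f i (limit_weights i) = loss f i (weights G \<Lambda> i)"
      unfolding loss_def
      using least_squares_mult_unique[OF pa_mat_carrier(1) col_f_carrier(1) limit_weights_least_squares[OF i]] mle i by metis
    thus ?thesis using mle i by (auto simp: dag_params_iff)
  qed
  thus ?thesis
    using limit_matrix limit_weights_least_squares unfolding limit_mle_def is_mle_iff[OF f] by (auto simp: dag_params_iff)
qed

section \<open>Identification of the explicit formula\<close>

lemma bar_col_eq:
  assumes Y: "Y \<in> carrier_mat n m" and x: "least_squares (pa_mat n G Y i) (col Y i) x"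
  shows "bar_col n G Y i = pa_mat n G Y i *\<^sub>v x"
  unfolding bar_col_def pa_cols_def set_cols_pa_mat[OF Y, symmetric]
  using Y by (intro orth_proj_cols[OF pa_mat_carrier(1) _ x]) (auto intro!: carrier_vecI)

text \<open>The residual is orthogonal to the parent columns, so projecting the column first does
  not change its inner products with them. Hence \<open>pa_inner\<close> supplies the right-hand
  sides of the normal equations.\<close>

lemma pa_inner_eq:
  fixes Y :: "'a mat"
  assumes Y: "Y \<in> carrier_mat n m"
  shows "pa_inner n G Y i = mat_adjoint (pa_mat n G Y i) *\<^sub>v col Y i"
proof -
  let ?M = "pa_mat n G Y i" and ?p = "card (pa G i)"
  have cY: "col Y i \<in> carrier_vec n" using Y by (auto intro!: carrier_vecI)
  obtain x where x: "least_squares ?M (col Y i) x"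
    using least_squares_exists[OF pa_mat_carrier(1) cY] by blast
  hence xc: "x \<in> carrier_vec ?p" by (simp add: least_squares_def)
  have Mx: "?M *\<^sub>v x \<in> carrier_vec n" by (rule mult_mat_vec_carrier[OF pa_mat_carrier(1) xc])
  have "pa_inner n G Y i = mat_adjoint ?M *\<^sub>v (?M *\<^sub>v x)"
    unfolding pa_inner_def bar_col_eq[OF Y x]
  proof (rule eq_vecI)
    fix k assume "k < dim_vec (mat_adjoint ?M *\<^sub>v (?M *\<^sub>v x))"
    hence k: "k < ?p" by simp
    have "(mat_adjoint ?M *\<^sub>v u) $ k = u \<bullet>c col ?M k" if "u \<in> carrier_vec n" for u
      using k that by (auto simp: scalar_prod_def mult.commute intro!: sum.cong)
    thus "pa_vec G i (\<lambda>j. (?M *\<^sub>v x) \<bullet>c col Y j) $ k = (mat_adjoint ?M *\<^sub>v (?M *\<^sub>v x)) $ k"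
      using k Mx by (simp add: col_pa_mat[OF Y k])
  qed simp
  also have "\<dots> = mat_adjoint ?M *\<^sub>v col Y i"
    using x unfolding least_squares_iff_gram[OF pa_mat_carrier(1) cY] gram_mult_vec[OF pa_mat_carrier(1) xc]
    by blast
  finally show ?thesis .
qed

lemma c_coeff_eq:
  assumes i: "i < m"
  shows "c_coeff n G f f' i l = fact l * coeff (det (ridge_regression.pencil (card (pa G i)) (A i) (E i))) l"
proof -
  interpret ridge_regression n n "card (pa G i)" "A i" "E i" "col f i" "col f' i" by (rule ridge[OF i])
  show ?thesis
    using poly_det_pencil[of 0] mat_trace_deriv_adj by (cases l) (auto simp: C_mat_def poly_0_coeff_0)
qed

text \<open>Numerator and denominator carry the same factorial, which cancels. At a vertex without
  parents the weight vector is empty, so the right side may range over all vertices.\<close>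

lemma explicit_weights_iff:
  "explicit_weights n m G f f' \<Lambda> \<longleftrightarrow> (\<forall>i<m. weights G \<Lambda> i = limit_weights i)"
proof -
  have "inverse (c_coeff n G f f' i (l_index n G f f' i)) \<cdot>\<^sub>v D_coeff n G f f' i (l_index n G f f' i) = limit_weights i"
    if i: "i < m" for i
  proof -
    interpret ridge_regression n n "card (pa G i)" "A i" "E i" "col f i" "col f' i" by (rule ridge[OF i])
    have l: "l_index n G f f' i = ord"
      unfolding l_index_def ord_eq c_coeff_eq[OF i] by simp
    have "inverse (fact ord * c) * fact ord = inverse c" for c :: 'a by simp
    thus ?thesis
      unfolding l D_coeff_def C_mat_def pa_inner_eq[OF f] pa_inner_eq[OF f'] num_coeff_Leibniz
        c_coeff_eq[OF i] limit_weights_def ridge_limit_def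
      by (simp only: smult_smult_assoc)
  qed
  moreover have "weights G \<Lambda> i = limit_weights i" if "i < m" "pa G i = {}" for i
    using that limit_weights_carrier[OF that(1)] by (intro eq_vecI) auto
  ultimately show ?thesis
    unfolding explicit_weights_def Let_def by metis
qed

text \<open>The weight vectors at all vertices determine \<open>\<Lambda>\<close>, and the variances
  of an MLE are determined by its weights. So at most one MLE satisfies the formula.\<close>

lemma explicit_mle_iff:
  assumes "\<exists>q. is_mle n m G f q"
  shows "is_mle n m G f q \<and> explicit_weights n m G f f' (fst q) \<longleftrightarrow> q = limit_mle"
proof
  assume q: "is_mle n m G f q \<and> explicit_weights n m G f f' (fst q)"
  obtain \<Lambda> \<omega> where eq: "q = (\<Lambda>, \<omega>)" by (cases q)
  note q = q[unfolded eq is_mle_iff[OF f] explicit_weights_iff]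
  have "\<Lambda> = limit_matrix"
    using q limit_matrix by (intro edge_weights_eqI) (auto simp: dag_params_iff)
  moreover have "\<omega> = Matrix.vec m (\<lambda>i. loss f i (limit_weights i) / n)"
    using q by (intro eq_vecI) (auto simp: dag_params_iff)
  ultimately show "q = limit_mle" by (simp add: eq limit_mle_def)
next
  assume "q = limit_mle"
  thus "is_mle n m G f q \<and> explicit_weights n m G f f' (fst q)"
    using assms is_mle_limit_mle limit_matrix(2) by (auto simp: explicit_weights_iff limit_mle_def)
qed

section \<open>When the MLE of the stabilisation is an MLE of f\<close>

lemma stabilised_one: "f + 1 \<cdot>\<^sub>m f' = f + f'"
  by (intro eq_matI) auto

text \<open>The loss of f + f' is the sum of the losses of f and f', so equal losses on the left
  mean that x fits the column of f' exactly. On the right, orthogonality of the images produces one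
  y that fits both the projected column of f and the column of f'.\<close>

lemma vertex_condition:
  assumes i: "i < m" and x: "least_squares (pa_mat n G (f + f') i) (col (f + f') i) x"
  shows "least_squares (A i) (col f i) x \<and> loss (f + f') i x = loss f i x \<longleftrightarrow>
    col f' i \<in> mat_image (E i) \<and> bar_col n G f i + col f' i \<in> mat_image (pa_mat n G (f + f') i)"
    (is "?L \<longleftrightarrow> ?R")
proof -
  let ?p = "card (pa G i)"
  have xc: "x \<in> carrier_vec ?p" using x by (simp add: least_squares_def)
  have loss: "loss (f + f') i y = loss f i y + loss f' i y" if y: "y \<in> carrier_vec ?p" for y
  proof -
    obtain u v where uv: "u \<in> carrier_vec m" "col f i - A i *\<^sub>v y = f *\<^sub>v u"
      "v \<in> carrier_vec m" "col f' i - E i *\<^sub>v y = f' *\<^sub>v v"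
      using residual_in_image[OF f i y] residual_in_image[OF f' i y] by blast
    have "col (f + f') i - pa_mat n G (f + f') i *\<^sub>v y = f *\<^sub>v u + f' *\<^sub>v v"
      using stabilised_residual[OF i y, of 1] uv by (simp add: stabilised_one)
    thus ?thesis
      unfolding loss_def uv(2,4) using uv norm_sq_add_orthogonal[OF mult_mat_vec_carrier[OF f] mult_mat_vec_carrier[OF f']]
        images_orthogonal by simp
  qed
  have loss0: "loss f' i y = 0 \<longleftrightarrow> col f' i = E i *\<^sub>v y" if y: "y \<in> carrier_vec ?p" for y
    unfolding loss_def using y mult_mat_vec_carrier[OF pa_mat_carrier(1) y, of f']
    by (subst norm_sq_eq_0_iff[of _ n]) (auto simp: minus_eq_zero_vec_iff[of _ n])
  have mult: "pa_mat n G (f + f') i *\<^sub>v y = A i *\<^sub>v y + E i *\<^sub>v y" if "y \<in> carrier_vec ?p" for y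
    using that pa_mat_stabilised[of 1 i] unfolding stabilised_one
    by (simp add: add_mult_distrib_mat_vec[of _ n ?p] smult_mat_mult_vec[of _ n ?p])
  show ?thesis
  proof
    assume L: ?L
    hence "col f' i = E i *\<^sub>v x" using loss[OF xc] loss0[OF xc] by simp
    moreover have "bar_col n G f i = A i *\<^sub>v x" using L bar_col_eq[OF f] by blast
    ultimately show ?R using xc mult[OF xc] by (auto simp: mat_image_def intro!: image_eqI[of _ _ x])
  next
    assume R: ?R
    then obtain y where y: "y \<in> carrier_vec ?p" "bar_col n G f i + col f' i = A i *\<^sub>v y + E i *\<^sub>v y"
      using mult by (auto simp: mat_image_def)
    obtain z where z: "least_squares (A i) (col f i) z"
      using least_squares_exists[OF pa_mat_carrier(1) col_f_carrier(1)] by blast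
    hence zc: "z \<in> carrier_vec ?p" by (simp add: least_squares_def)
    have c: "A i *\<^sub>v z \<in> carrier_vec n" "A i *\<^sub>v y \<in> carrier_vec n" "E i *\<^sub>v y \<in> carrier_vec n"
      by (auto intro: mult_mat_vec_carrier[OF pa_mat_carrier(1)] y zc)
    obtain u where u: "u \<in> carrier_vec m" "A i *\<^sub>v (z - y) = f *\<^sub>v u"
      using pa_mat_mult_in_image[OF f, of "z - y" i] zc y by auto
    obtain v where v: "v \<in> carrier_vec m" "col f' i - E i *\<^sub>v y = f' *\<^sub>v v"
      using residual_in_image[OF f' i y(1)] by blast
    have eq: "A i *\<^sub>v z + col f' i = A i *\<^sub>v y + E i *\<^sub>v y" using y(2) bar_col_eq[OF f z] by simp
    \<comment> \<open>The span membership, rearranged into a value of f plus a value of f'. By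
      orthogonality both are zero, which separates the equation into one for \<open>A i\<close> and
      one for \<open>E i\<close>.\<close>
    have sum0: "f *\<^sub>v u + f' *\<^sub>v v = 0\<^sub>v n"
      unfolding u(2)[symmetric] v(2)[symmetric] mult_mat_vec_diff[OF pa_mat_carrier(1) zc y(1)]
    proof (rule eq_vecI)
      fix k assume "k < dim_vec (0\<^sub>v n :: 'a vec)"
      thus "(A i *\<^sub>v z - A i *\<^sub>v y + (col f' i - E i *\<^sub>v y)) $ k = 0\<^sub>v n $ k"
        using arg_cong[OF eq, of "\<lambda>u. u $ k"] c by (simp add: algebra_simps del: index_mult_mat_vec)
    qed auto
    have "f *\<^sub>v u = 0\<^sub>v n" "f' *\<^sub>v v = 0\<^sub>v n"
      using orthogonal_add_eq_0[OF mult_mat_vec_carrier[OF f u(1)] mult_mat_vec_carrier[OF f' v(1)]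
        images_orthogonal(2)[OF v(1) u(1)] sum0] by auto
    hence Azy: "A i *\<^sub>v z = A i *\<^sub>v y" and Ey: "col f' i = E i *\<^sub>v y"
      using u(2) v(2) mult_mat_vec_diff[OF pa_mat_carrier(1) zc y(1), of f]
        minus_eq_zero_vec_iff[OF c(1,2)] minus_eq_zero_vec_iff[OF col_f_carrier(2) c(3)] by auto
    have ly: "least_squares (A i) (col f i) y" using z y(1) Azy by (auto simp: least_squares_def)
    \<comment> \<open>x minimises the summed loss and y attains the minimum of each summand, so x
      attains both minima as well.\<close>
    have "loss (f + f') i x \<le> loss (f + f') i y"
      using x y(1) least_squares_iff_loss[OF _ i, of "f + f'"] by auto
    hence le: "loss f i x + loss f' i x \<le> loss f i y"
      using loss[OF xc] loss[OF y(1)] loss0[OF y(1)] Ey by simp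
    have min: "\<forall>u\<in>carrier_vec ?p. loss f i y \<le> loss f i u" using ly least_squares_iff_loss[OF f i] by blast
    hence "loss f i x = loss f i y" "loss f' i x = 0"
      using le xc loss_nonneg[of f' i x] by force+
    thus ?L using min xc loss[OF xc] least_squares_iff_loss[OF f i] by auto
  qed
qed

text \<open>Positive variances are inherited from the MLE of f + f'. What remains at each vertex are
  the normal equations for f and the equality of the two losses.\<close>

lemma stabilised_mle_is_mle_iff:
  "is_mle n m G f (mle n m G (f + f')) \<longleftrightarrow>
    (\<forall>i<m. col f' i \<in> mat_image (E i) \<and> bar_col n G f i + col f' i \<in> mat_image (pa_mat n G (f + f') i))"
proof -
  obtain \<Lambda> \<omega> where eq: "mle n m G (f + f') = (\<Lambda>, \<omega>)" by fastforce
  have ff': "f + f' \<in> carrier_mat n m" by simp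
  have mle: "(\<Lambda>, \<omega>) \<in> dag_params m G"
    "i < m \<Longrightarrow> least_squares (pa_mat n G (f + f') i) (col (f + f') i) (weights G \<Lambda> i)"
    "i < m \<Longrightarrow> \<omega> $ i = loss (f + f') i (weights G \<Lambda> i) / n" for i
    using is_mle_mle[of 1] unfolding stabilised_one eq is_mle_iff[OF ff'] by auto
  have "is_mle n m G f (\<Lambda>, \<omega>) \<longleftrightarrow> (\<forall>i<m. least_squares (A i) (col f i) (weights G \<Lambda> i) \<and>
      loss (f + f') i (weights G \<Lambda> i) = loss f i (weights G \<Lambda> i))"
    unfolding is_mle_iff[OF f] using mle le by auto
  thus ?thesis unfolding eq using vertex_condition[OF _ mle(2)] by auto
qed

lemma vspan_pa: "Y \<in> carrier_mat n m \<Longrightarrow> vspan n (col Y ` pa G i) = mat_image (pa_mat n G (Y :: 'a mat) i)"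
  unfolding set_cols_pa_mat[symmetric] by (rule vspan_cols[OF pa_mat_carrier(1)])

text \<open>At a vertex i without parents the optimal variances for f + f' and for f are (|f_i|^2 +
  |v_i|^2) / n and |f_i|^2 / n, which agree only if v_i = 0. The criterion on child vertices does
  not see this, whence the second clause.\<close>

lemma stabilised_mle_is_mle_iff_span:
  "is_mle n m G f (mle n m G (f + f')) \<longleftrightarrow>
    (\<forall>i<m. pa G i \<noteq> {} \<longrightarrow>
       col f' i \<in> vspan n (col f' ` pa G i) \<and>
       bar_col n G f i + col f' i \<in> vspan n ((\<lambda>j. col f j + col f' j) ` pa G i)) \<and>
    (\<forall>i<m. pa G i = {} \<longrightarrow> col f' i = 0\<^sub>v n)"
proof -
  have "(\<lambda>j. col f j + col f' j) ` pa G i = col (f + f') ` pa G i" for i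
    by (intro image_cong refl eq_vecI) (auto dest: pa_less)
  hence span: "vspan n ((\<lambda>j. col f j + col f' j) ` pa G i) = mat_image (pa_mat n G (f + f') i)" for i
    using vspan_pa[of "f + f'" i] by simp
  have "col f' i \<in> mat_image (E i) \<and> bar_col n G f i + col f' i \<in> mat_image (pa_mat n G (f + f') i)
      \<longleftrightarrow> col f' i = 0\<^sub>v n" if i: "i < m" and empty: "pa G i = {}" for i
  proof -
    have 0: "pa_mat n G Y i *\<^sub>v x = 0\<^sub>v n" if "x \<in> carrier_vec 0" for x :: "'a vec" and Y :: "'a mat"
      using that empty by (intro eq_vecI) (auto simp: scalar_prod_def)
    have image: "mat_image (pa_mat n G Y i) = {0\<^sub>v n}" for Y :: "'a mat"
      using 0 empty by (auto simp: mat_image_def intro!: image_eqI[of _ _ "0\<^sub>v 0"])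
    have "bar_col n G f i = 0\<^sub>v n"
      using bar_col_eq[OF f limit_weights_least_squares[OF i]] 0 limit_weights_carrier[OF i] empty by simp
    thus ?thesis unfolding image by auto
  qed
  thus ?thesis unfolding stabilised_mle_is_mle_iff vspan_pa[OF f'] span by blast
qed

end

theorem theorem1p1:
  fixes n m :: nat
    and G :: "(nat \<times> nat) set"
    and f f' :: "'a :: real_or_complex mat"
  assumes "m \<le> n"
    and "dag m G"
    and "f \<in> carrier_mat n m"
    and "perturbation n m f f'"
  shows
    "(\<exists>!p. is_mle n m G (f + f') p) \<and>
     (is_mle n m G f (mle n m G (f + f')) \<longleftrightarrow>
        (\<forall>i<m. pa G i \<noteq> {} \<longrightarrow>
           col f' i \<in> vspan n (col f' ` pa G i) \<and>
           bar_col n G f i + col f' i \<in> vspan n ((\<lambda>j. col f j + col f' j) ` pa G i)) \<and>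
        (\<forall>i<m. pa G i = {} \<longrightarrow> col f' i = 0\<^sub>v n)) \<and>
     ((\<forall>\<epsilon>. \<epsilon> \<noteq> 0 \<longrightarrow> (\<exists>!p. is_mle n m G (f + \<epsilon> \<cdot>\<^sub>m f') p)) \<and>
      (\<exists>!L. is_limit_mle n m G f f' L) \<and>
      (\<forall>L. is_limit_mle n m G f f' L \<longrightarrow> (\<exists>q. is_mle n m G f q) \<longrightarrow>
         (\<forall>q. is_mle n m G f q \<and> explicit_weights n m G f f' (fst q) \<longleftrightarrow> q = L))) \<and>
     (\<forall>L. is_limit_mle n m G f f' L \<longrightarrow> (\<exists>q. is_mle n m G f q) \<longrightarrow> is_mle n m G f L)"
proof -
  interpret stabilisation n m G f f' using assms by unfold_locales
  have "\<exists>!p. is_mle n m G (f + f') p"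
    using stabilised_mle_unique[of 1] by (simp add: stabilised_one)
  moreover note stabilised_mle_is_mle_iff_span
  moreover have "\<forall>\<epsilon>. \<epsilon> \<noteq> 0 \<longrightarrow> (\<exists>!p. is_mle n m G (f + \<epsilon> \<cdot>\<^sub>m f') p)"
    using stabilised_mle_unique by blast
  moreover have "\<exists>!L. is_limit_mle n m G f f' L"
    unfolding is_limit_mle_iff by simp
  moreover have "\<forall>L. is_limit_mle n m G f f' L \<longrightarrow> (\<exists>q. is_mle n m G f q) \<longrightarrow>
      (\<forall>q. is_mle n m G f q \<and> explicit_weights n m G f f' (fst q) \<longleftrightarrow> q = L)"
    unfolding is_limit_mle_iff using explicit_mle_iff by blast
  moreover have "\<forall>L. is_limit_mle n m G f f' L \<longrightarrow> (\<exists>q. is_mle n m G f q) \<longrightarrow> is_mle n m G f L"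
    unfolding is_limit_mle_iff using is_mle_limit_mle by blast
  ultimately show ?thesis by (intro conjI)
qed

end
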